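(* Let $\mathcal{M}=(S,A,T,\Sigma,L)$ be an MDP with initial state $s_0$, let $\mathcal{A}=\langle\Sigma,Q,q_0,\Delta,\Gamma\rangle$ be a good-for-MDPs (transition-based) B\"uchi automaton, and let $\zeta\in\,]0,1[$. Let $\mathcal{M}^\zeta$ and $\overline{\mathcal{M}}^\zeta$ be the augmented MDPs obtained from the product $\mathcal{M}\times\mathcal{A}$ as described in the context. Then: \begin{enumerate} \item $\overline{\mathcal{M}}^\zeta$, $\mathcal{M}^\zeta$ and $\mathcal{M}\times\mathcal{A}$ have the same set of strategies. \item For every strategy $f$, $\mathrm{PSat}^{\mathcal{M}^\zeta}_t((s_0,q_0),f)=(1-\zeta)\,\mathrm{ETotal}^{\overline{\mathcal{M}}^\zeta}((s_0,q_0),f)$; i.e., the expected total reward in $\overline{\mathcal{M}}^\zeta$ under $f$ is $r$ if and only if the probability of reaching $t$ in $\mathcal{M}^\zeta$ under $f$ is $(1-\zeta)r$. \item For every strategy $f$, the expected total reward $\mathrm{ETotal}^{\overline{\mathcal{M}}^\zeta}((s_0,q_0),f)$ lies in $[0,\frac{1}{1-\zeta}]$. \item For every strategy $f$, the probability that a run of $(\mathcal{M}\times\mathcal{A})$ under $f$ from $(s_0,q_0)$ satisfies the B\"uchi condition (uses accepting transitions infinitely often) is $1$ if and only if $\mathrm{ETotal}^{\overline{\mathcal{M}}^\zeta}((s_0,q_0),f)=\frac{1}{1-\zeta}$. \item There is $\zeta_0\in\,]0,1[$ such that for all $\zeta\in[\zeta_0,1[$, every strategy $f$ that maximises $\mathrm{ETotal}^{\overline{\mathcal{M}}^\zeta}((s_0,q_0),f)$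 is an optimal strategy for the B\"uchi objective in $\mathcal{M}\times\mathcal{A}$, i.e. $\mathrm{PSat}^{\mathcal{M}}_{\mathcal{A}}((s_0,q_0),f)=\sup_{g}\mathrm{PSat}^{\mathcal{M}}_{\mathcal{A}}((s_0,q_0),g)$. \end{enumerate}
   Context: A (transition-based) B\"uchi automaton $\mathcal{A}=\langle\Sigma,Q,q_0,\Delta,\Gamma\rangle$ has finite alphabet $\Sigma$, finite state set $Q$, initial state $q_0$, transitions $\Delta\subseteq Q\times\Sigma\times Q$ and accepting transitions $\Gamma\subseteq Q\times\Sigma\times Q$; a run on $w\in\Sigma^\omega$ is accepting if some transition of $\Gamma$ occurs infinitely often, and $L_{\mathcal{A}}$ is the set of words with an accepting run. An MDP $\mathcal{M}=(S,A,T,\Sigma,L)$ has finite states $S$, finite actions $A$ ($A(s)$ the actions available at $s$), transition function $T:S\times A\to\mathrm{Dist}(S)$ and labelling $L:S\times A\times S\to\Sigma$ of transitions; runs $s_0a_1s_1a_2\dots$ have label $L(s_0,a_1,s_1)L(s_1,a_2,s_2)\dots$. A strategy maps finite runs to distributions over the actions available at the last state. The product $\mathcal{M}\times\mathcal{A}$ is the MDP with states $S\times Q$, initial state $(s_0,q_0)$, actions $A\times Q$, and $T^\times((s,q),(a,q'))((s',q'))=T(s,a)(s')$ if $(q,L(s,a,s'),q')\in\Delta$ and $0$ otherwise; its accepting transitions are the triples $((s,q),(a,q'),(s',q'))$ with $(q,L(s,a,s'),q')\in\Gamma$ and $T(s,a)(s')>0$. $\mathrm{PSat}^{\mathcal{M}}_{\mathcal{A}}((s,q),f)$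 is the probability, under strategy $f$ from $(s,q)$ in the product, that accepting transitions are taken infinitely often. $\mathcal{A}$ is good for MDPs if for every MDP $\mathcal{M}$, $\sup_f \mathrm{PSat}^{\mathcal{M}}_{\mathcal{A}}((s_0,q_0),f)$ equals $\sup_f$ of the probability that the label of the run of $\mathcal{M}$ under $f$ lies in $L_{\mathcal{A}}$. For $\zeta\in]0,1[$, $\mathcal{M}^\zeta$ is obtained from $\mathcal{M}\times\mathcal{A}$ by adding a new state $t$ at which the computation stops, and modifying every accepting transition: whenever an accepting transition to $(s',q')$ (of original probability $p$) is taken, with probability $p(1-\zeta)$ the run goes to $t$ instead, and with probability $p\zeta$ it goes to $(s',q')$. $\mathrm{PSat}^{\mathcal{M}^\zeta}_t((s,q),f)$ is the probability of reaching $t$ under $f$ from $(s,q)$. $\overline{\mathcal{M}}^\zeta$ is the same MDP as $\mathcal{M}^\zeta$, equipped with an undiscounted reward: each time an accepting transition (of $\mathcal{M}\times\mathcal{A}$) is taken, a reward $1$ is obtained, whether it leads to $t$ or stays in $S\times Q$. For a run $r$ containing $n\in\mathbb{N}_0\cup\{\infty\}$ accepting transitions, $\mathrm{Total}(r)=n$, and $\mathrm{ETotal}^{\overline{\mathcal{M}}^\zeta}((s,q),f)$ is the expectation of $\mathrm{Total}$ over runs from $(s,q)$ under $f$. *)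

theory Defs
  imports "HOL-Probability.Probability"
begin

section \<open>Finite Markov decision processes\<close>

text \<open>
  Transition functions take values in the discrete sub-distributions of the library
  (\<open>'s spmf\<close>). An MDP proper has lossless ones, i.e. distributions (see \<open>labelled_mdp\<close>).
  The extra generality is needed for the product with an automaton, whose transition function need
  not have total mass 1.
\<close>

record ('s, 'a) mdp =
  states :: "'s set"
  actions :: "'a set"
  start :: 's
  avail :: "'s \<Rightarrow> 'a set"
  transition :: "'s \<Rightarrow> 'a \<Rightarrow> 's spmf"

record ('s, 'a, 'l) lmdp = "('s, 'a) mdp" +
  label :: "'s \<Rightarrow> 'a \<Rightarrow> 's \<Rightarrow> 'l"

record ('s, 'a) rmdp = "('s, 'a) mdp" +
  reward :: "'s \<Rightarrow> 'a \<Rightarrow> 's \<Rightarrow> ennreal"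

definition labelled_mdp :: "'l set \<Rightarrow> ('s, 'a, 'l) lmdp \<Rightarrow> bool" where
  "labelled_mdp \<Sigma> M \<longleftrightarrow>
     finite (states M) \<and> finite (actions M) \<and> start M \<in> states M \<and>
     (\<forall>s\<in>states M. avail M s \<noteq> {} \<and> avail M s \<subseteq> actions M \<and>
       (\<forall>a\<in>avail M s.
          lossless_spmf (transition M s a) \<and> set_spmf (transition M s a) \<subseteq> states M \<and>
          (\<forall>s'\<in>states M. label M s a s' \<in> \<Sigma>)))"


subsection \<open>Finite runs and strategies\<close>

text \<open>The finite run \<open>s\<^sub>0 a\<^sub>1 s\<^sub>1 \<dots> a\<^sub>n s\<^sub>n\<close> is the pair \<open>(s\<^sub>0, [(a\<^sub>1, s\<^sub>1), \<dots>, (a\<^sub>n, s\<^sub>n)])\<close>.\<close>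

type_synonym ('s, 'a) frun = "'s \<times> ('a \<times> 's) list"

type_synonym ('s, 'a) strategy = "('s, 'a) frun \<Rightarrow> 'a pmf"

fun is_path :: "('s, 'a, 'z) mdp_scheme \<Rightarrow> 's \<Rightarrow> ('a \<times> 's) list \<Rightarrow> bool" where
  "is_path M s [] \<longleftrightarrow> s \<in> states M"
| "is_path M s ((a, s') # xs) \<longleftrightarrow>
     s \<in> states M \<and> a \<in> avail M s \<and> spmf (transition M s a) s' > 0 \<and> is_path M s' xs"

definition finite_runs :: "('s, 'a, 'z) mdp_scheme \<Rightarrow> ('s, 'a) frun set" where
  "finite_runs M = {(s, xs). is_path M s xs}"

fun last_state :: "('s, 'a) frun \<Rightarrow> 's" where
  "last_state (s, xs) = (if xs = [] then s else snd (last xs))"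

text \<open>
  A run that reaches a state without available actions stops there, so there is nothing to choose
  after it. Strategies are extensional functions (\<open>undefined\<close> outside their domain), so that
  equality of sets of strategies is meaningful.
\<close>

definition decision_runs :: "('s, 'a, 'z) mdp_scheme \<Rightarrow> ('s, 'a) frun set" where
  "decision_runs M = {r \<in> finite_runs M. avail M (last_state r) \<noteq> {}}"

definition strategies :: "('s, 'a, 'z) mdp_scheme \<Rightarrow> ('s, 'a) strategy set" where
  "strategies M = (\<Pi>\<^sub>E r\<in>decision_runs M. {p. set_pmf p \<subseteq> avail M (last_state r)})"


subsection \<open>The probability space of runs\<close>

text \<open>
  A run from a fixed state \<open>s\<close> is a function \<open>\<omega>\<close> on \<open>nat\<close>: \<open>\<omega> i = Some (a, s')\<close> says that in step \<open>i\<close>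
  action \<open>a\<close> is chosen and leads to \<open>s'\<close>, and \<open>\<omega> i = None\<close> says that the run has stopped before
  completing step \<open>i\<close>. A run stops if its current state has no available action, or with the mass
  missing from a sub-distribution.
\<close>

type_synonym ('s, 'a) run = "nat \<Rightarrow> ('a \<times> 's) option"

definition next_step :: "('s, 'a, 'z) mdp_scheme \<Rightarrow> ('s, 'a) strategy \<Rightarrow> ('s, 'a) frun \<Rightarrow> ('a \<times> 's) spmf" where
  "next_step M f r =
     (if r \<in> decision_runs M
      then bind_pmf (f r) (\<lambda>a. map_spmf (Pair a) (transition M (last_state r) a))
      else return_pmf None)"

definition steps :: "('s, 'a, 'z) mdp_scheme \<Rightarrow> ('a \<times> 's) option set" where
  "steps M = insert None (Some ` (actions M \<times> states M))"

definition step_kernel ::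
  "('s, 'a, 'z) mdp_scheme \<Rightarrow> ('s, 'a) strategy \<Rightarrow> 's \<Rightarrow> nat \<Rightarrow> ('s, 'a) run \<Rightarrow> ('a \<times> 's) option measure" where
  "step_kernel M f s i \<omega> =
     restrict_space
       (measure_pmf
         (if \<forall>j<i. \<omega> j \<noteq> None then next_step M f (s, map (the \<circ> \<omega>) [0..<i]) else return_pmf None))
       (steps M)"

definition run_measure :: "('s, 'a, 'z) mdp_scheme \<Rightarrow> ('s, 'a) strategy \<Rightarrow> 's \<Rightarrow> ('s, 'a) run measure" where
  "run_measure M f s =
     projective_family.lim UNIV
       (Ionescu_Tulcea.CI (step_kernel M f s) (\<lambda>_. count_space (steps M)))
       (\<lambda>_. count_space (steps M))"

definition well_formed :: "('s, 'a, 'z) mdp_scheme \<Rightarrow> bool" where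
  "well_formed M \<longleftrightarrow> finite (states M) \<and> finite (actions M) \<and>
     (\<forall>s\<in>states M. avail M s \<subseteq> actions M \<and> (\<forall>a\<in>avail M s. set_spmf (transition M s a) \<subseteq> states M))"

lemma well_formed_labelled_mdp: "labelled_mdp \<Sigma> M \<Longrightarrow> well_formed M"
  by (auto simp: labelled_mdp_def well_formed_def)

lemma last_state_in_states: "well_formed M \<Longrightarrow> r \<in> finite_runs M \<Longrightarrow> last_state r \<in> states M"
proof -
  have "is_path M s xs \<Longrightarrow> last_state (s, xs) \<in> states M" for s xs
    by (induction M s xs rule: is_path.induct) auto
  then show "r \<in> finite_runs M \<Longrightarrow> last_state r \<in> states M"
    by (auto simp: finite_runs_def)
qed

lemma set_next_step:
  assumes "well_formed M" "f \<in> strategies M"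
  shows "set_pmf (next_step M f r) \<subseteq> steps M"
proof (cases "r \<in> decision_runs M")
  case True
  have "last_state r \<in> states M"
    using True last_state_in_states[OF assms(1), of r] by (simp add: decision_runs_def)
  then have act: "a \<in> actions M \<and> set_spmf (transition M (last_state r) a) \<subseteq> states M"
    if "a \<in> set_pmf (f r)" for a
  proof -
    have "a \<in> avail M (last_state r)"
      using PiE_mem[OF assms(2)[unfolded strategies_def] True] that by auto
    with \<open>last_state r \<in> states M\<close> assms(1) show ?thesis
      unfolding well_formed_def by blast
  qed
  show ?thesis
  proof
    fix y assume "y \<in> set_pmf (next_step M f r)"
    then obtain a z where "a \<in> set_pmf (f r)" "z \<in> set_pmf (transition M (last_state r) a)"
      "y = map_option (Pair a) z"
      using True by (auto simp: next_step_def)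
    with act[of a] show "y \<in> steps M"
      by (cases z) (auto simp: steps_def in_set_spmf)
  qed
qed (simp add: next_step_def steps_def)

text \<open>\<open>run_measure\<close> is the measure given by the Ionescu-Tulcea theorem.\<close>

lemma Ionescu_Tulcea_step_kernel:
  assumes "well_formed M" "f \<in> strategies M"
  shows "Ionescu_Tulcea (step_kernel M f s) (\<lambda>_. count_space (steps M))"
proof (rule Ionescu_Tulcea.intro)
  have fin: "finite (steps M)"
    using assms(1) by (auto simp: steps_def well_formed_def)
  have prob: "prob_space (step_kernel M f s i \<omega>)" for i \<omega>
  proof -
    define p where
      "p = (if \<forall>j<i. \<omega> j \<noteq> None then next_step M f (s, map (the \<circ> \<omega>) [0..<i]) else return_pmf None)"
    have "set_pmf p \<subseteq> steps M"
      using set_next_step[OF assms] by (simp add: p_def steps_def)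
    then have "emeasure (measure_pmf p) (steps M) = 1"
      by (subst measure_pmf.emeasure_eq_1_AE) (auto simp: AE_measure_pmf_iff)
    then show ?thesis
      unfolding step_kernel_def p_def[symmetric]
      by (intro prob_spaceI) (simp add: space_restrict_space emeasure_restrict_space)
  qed
  show "prob_space (step_kernel M f s i \<omega>)"
    if "\<omega> \<in> space (PiM {0..<i} (\<lambda>_. count_space (steps M)))" for i \<omega>
    by (rule prob)
  have "sets (step_kernel M f s i \<omega>) = Pow (steps M)" for i \<omega>
    by (auto simp: step_kernel_def sets_restrict_space)
  then show "step_kernel M f s i \<in>
      measurable (PiM {0..<i} (\<lambda>_. count_space (steps M))) (subprob_algebra (count_space (steps M)))" for i
    by (subst count_space_PiM_finite)
      (auto simp: fin countable_finite space_subprob_algebra prob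
            intro: prob_space_imp_subprob_space)
qed


subsection \<open>Events and total reward\<close>

definition state_at :: "'s \<Rightarrow> ('s, 'a) run \<Rightarrow> nat \<Rightarrow> 's option" where
  "state_at s \<omega> i = (case i of 0 \<Rightarrow> Some s | Suc j \<Rightarrow> map_option snd (\<omega> j))"

definition triple_at :: "'s \<Rightarrow> ('s, 'a) run \<Rightarrow> nat \<Rightarrow> ('s \<times> 'a \<times> 's) option" where
  "triple_at s \<omega> i =
     (case (state_at s \<omega> i, \<omega> i) of (Some u, Some (a, u')) \<Rightarrow> Some (u, a, u') | _ \<Rightarrow> None)"

definition takes :: "('s \<times> 'a \<times> 's) set \<Rightarrow> 's \<Rightarrow> ('s, 'a) run \<Rightarrow> nat \<Rightarrow> bool" where
  "takes E s \<omega> i \<longleftrightarrow> (\<exists>e\<in>E. triple_at s \<omega> i = Some e)"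

definition prob_buchi ::
  "('s, 'a, 'z) mdp_scheme \<Rightarrow> ('s \<times> 'a \<times> 's) set \<Rightarrow> 's \<Rightarrow> ('s, 'a) strategy \<Rightarrow> real" where
  "prob_buchi M E s f = \<P>(\<omega> in run_measure M f s. \<exists>\<^sub>\<infinity>i. takes E s \<omega> i)"

definition prob_reach :: "('s, 'a, 'z) mdp_scheme \<Rightarrow> 's \<Rightarrow> 's \<Rightarrow> ('s, 'a) strategy \<Rightarrow> real" where
  "prob_reach M t s f = \<P>(\<omega> in run_measure M f s. \<exists>i. state_at s \<omega> i = Some t)"

definition total :: "('s, 'a) rmdp \<Rightarrow> 's \<Rightarrow> ('s, 'a) run \<Rightarrow> ennreal" where
  "total M s \<omega> = (\<Sum>i. case triple_at s \<omega> i of None \<Rightarrow> 0 | Some (u, a, u') \<Rightarrow> reward M u a u')"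

definition etotal :: "('s, 'a) rmdp \<Rightarrow> 's \<Rightarrow> ('s, 'a) strategy \<Rightarrow> ennreal" where
  "etotal M s f = (\<integral>\<^sup>+\<omega>. total M s \<omega> \<partial>run_measure M f s)"


section \<open>Transition-based Buechi automata\<close>

record ('l, 'q) buchi =
  alphabet :: "'l set"
  astates :: "'q set"
  astart :: 'q
  delta :: "('q \<times> 'l \<times> 'q) set"
  gamma :: "('q \<times> 'l \<times> 'q) set"

definition buchi_automaton :: "('l, 'q) buchi \<Rightarrow> bool" where
  "buchi_automaton A \<longleftrightarrow>
     finite (alphabet A) \<and> finite (astates A) \<and> astart A \<in> astates A \<and>
     delta A \<subseteq> astates A \<times> alphabet A \<times> astates A \<and>
     gamma A \<subseteq> astates A \<times> alphabet A \<times> astates A"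

definition accepting_run :: "('l, 'q) buchi \<Rightarrow> (nat \<Rightarrow> 'l) \<Rightarrow> (nat \<Rightarrow> 'q) \<Rightarrow> bool" where
  "accepting_run A w \<rho> \<longleftrightarrow>
     \<rho> 0 = astart A \<and> (\<forall>i. (\<rho> i, w i, \<rho> (Suc i)) \<in> delta A) \<and>
     (\<exists>e\<in>gamma A. \<exists>\<^sub>\<infinity>i. (\<rho> i, w i, \<rho> (Suc i)) = e)"

definition language :: "('l, 'q) buchi \<Rightarrow> (nat \<Rightarrow> 'l) set" where
  "language A = {w. (\<forall>i. w i \<in> alphabet A) \<and> (\<exists>\<rho>. accepting_run A w \<rho>)}"


section \<open>Product, good-for-MDPs, and augmented MDPs\<close>

text \<open>
  To have literally the same finite runs, and hence comparable strategies, in the product and in the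
  augmented MDPs, their states share one type. The element \<open>Target\<close> (the extra state \<open>t\<close>) is not a
  state of the product.
\<close>

datatype 'p aug = St 'p | Target

text \<open>
  The definition below amounts to \<open>spmf_product_transition\<close>: mass on successors whose label does not
  allow the automaton to move to the chosen \<open>q'\<close> is lost, i.e. the run stops.
\<close>

definition product_transition ::
  "('s, 'a, 'l) lmdp \<Rightarrow> ('l, 'q) buchi \<Rightarrow> ('s \<times> 'q) aug \<Rightarrow> 'a \<times> 'q \<Rightarrow> ('s \<times> 'q) aug spmf" where
  "product_transition M A x y =
     (case (x, y) of
        (St (s, q), (a, q')) \<Rightarrow>
          bind_spmf (transition M s a)
            (\<lambda>s'. if (q, label M s a s', q') \<in> delta A then return_spmf (St (s', q')) else return_pmf None)
      | (Target, _) \<Rightarrow> return_pmf None)"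

lemma spmf_product_transition:
  "spmf (product_transition M A (St (s, q)) (a, q')) (St (s', q'')) =
     (if q'' = q' \<and> (q, label M s a s', q') \<in> delta A then spmf (transition M s a) s' else 0)"
proof -
  let ?c = "if q'' = q' \<and> (q, label M s a s', q') \<in> delta A then 1 else 0 :: real"
  have step: "spmf (if (q, label M s a u, q') \<in> delta A then return_spmf (St (u, q')) else return_pmf None)
      (St (s', q'')) = indicat_real {s'} u * ?c" for u
    by (simp split: split_indicator)
  show ?thesis
    unfolding product_transition_def prod.case aug.case spmf_bind step
    by (simp add: spmf_conv_measure_spmf)
qed

definition product_mdp ::
  "('s, 'a, 'l) lmdp \<Rightarrow> ('l, 'q) buchi \<Rightarrow> (('s \<times> 'q) aug, 'a \<times> 'q) mdp" where
  "product_mdp M A =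
     \<lparr>states = St ` (states M \<times> astates A),
      actions = actions M \<times> astates A,
      start = St (start M, astart A),
      avail = (\<lambda>x. case x of St (s, q) \<Rightarrow> avail M s \<times> astates A | Target \<Rightarrow> {}),
      transition = product_transition M A\<rparr>"

definition accepting ::
  "('s, 'a, 'l) lmdp \<Rightarrow> ('l, 'q) buchi \<Rightarrow> (('s \<times> 'q) aug \<times> ('a \<times> 'q) \<times> ('s \<times> 'q) aug) set" where
  "accepting M A =
     {(St (s, q), (a, q'), St (s', q')) | s q a q' s'.
        s \<in> states M \<and> a \<in> avail M s \<and> (q, label M s a s', q') \<in> gamma A \<and> spmf (transition M s a) s' > 0}"

definition psat ::
  "('s, 'a, 'l) lmdp \<Rightarrow> ('l, 'q) buchi \<Rightarrow> ('s \<times> 'q) aug \<Rightarrow> (('s \<times> 'q) aug, 'a \<times> 'q) strategy \<Rightarrow> real" where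
  "psat M A x f = prob_buchi (product_mdp M A) (accepting M A) x f"

definition run_has_label :: "('s, 'a, 'l) lmdp \<Rightarrow> 's \<Rightarrow> ('s, 'a) run \<Rightarrow> (nat \<Rightarrow> 'l) \<Rightarrow> bool" where
  "run_has_label M s \<omega> w \<longleftrightarrow> (\<forall>i. \<exists>u a u'. triple_at s \<omega> i = Some (u, a, u') \<and> w i = label M u a u')"

definition prob_language ::
  "('s, 'a, 'l) lmdp \<Rightarrow> ('l, 'q) buchi \<Rightarrow> 's \<Rightarrow> ('s, 'a) strategy \<Rightarrow> real" where
  "prob_language M A s f = \<P>(\<omega> in run_measure M f s. \<exists>w\<in>language A. run_has_label M s \<omega> w)"

text \<open>
  HOL cannot quantify over types inside a formula. Every finite MDP is isomorphic to one whose
  states and actions are natural numbers, so it suffices to quantify over those.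
\<close>

definition good_for_mdps :: "('l, 'q) buchi \<Rightarrow> bool" where
  "good_for_mdps A \<longleftrightarrow>
     (\<forall>M :: (nat, nat, 'l) lmdp. labelled_mdp (alphabet A) M \<longrightarrow>
        (SUP f\<in>strategies (product_mdp M A). psat M A (start (product_mdp M A)) f) =
        (SUP f\<in>strategies M. prob_language M A (start M) f))"

definition augmented_transition ::
  "('s, 'a, 'l) lmdp \<Rightarrow> ('l, 'q) buchi \<Rightarrow> real \<Rightarrow> ('s \<times> 'q) aug \<Rightarrow> 'a \<times> 'q \<Rightarrow> ('s \<times> 'q) aug spmf" where
  "augmented_transition M A \<zeta> x y =
     bind_spmf (product_transition M A x y)
       (\<lambda>x'. if (x, y, x') \<in> accepting M A
             then map_pmf (\<lambda>b. Some (if b then x' else Target)) (bernoulli_pmf \<zeta>)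
             else return_spmf x')"

lemma spmf_augmented_transition_St:
  assumes "0 \<le> \<zeta>" "\<zeta> \<le> 1"
  shows "spmf (augmented_transition M A \<zeta> x y) (St z) =
     (if (x, y, St z) \<in> accepting M A then \<zeta> else 1) * spmf (product_transition M A x y) (St z)"
proof -
  have Collect_b: "{b. b} = {True}"
    by auto
  let ?c = "if (x, y, St z) \<in> accepting M A then \<zeta> else 1"
  have step: "spmf (if (x, y, x') \<in> accepting M A
        then map_pmf (\<lambda>b. Some (if b then x' else Target)) (bernoulli_pmf \<zeta>) else return_spmf x') (St z) =
      indicat_real {St z} x' * ?c" for x'
    using assms
    by (auto simp: pmf_map vimage_def measure_pmf_single Collect_b split: split_indicator)
  show ?thesis
    unfolding augmented_transition_def spmf_bind step
    by (simp add: spmf_conv_measure_spmf)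
qed

lemma spmf_augmented_transition_Target:
  assumes "0 \<le> \<zeta>" "\<zeta> \<le> 1"
  shows "spmf (augmented_transition M A \<zeta> (St u) y) Target =
     (1 - \<zeta>) * measure (measure_spmf (product_transition M A (St u) y)) {x'. (St u, y, x') \<in> accepting M A}"
proof -
  have Collect_b: "{b. \<not> b} = {False}"
    by auto
  let ?E = "{x'. (St u, y, x') \<in> accepting M A}"
  have step: "spmf (if (St u, y, x') \<in> accepting M A
        then map_pmf (\<lambda>b. Some (if b then x' else Target)) (bernoulli_pmf \<zeta>) else return_spmf x') Target =
      indicat_real ?E x' * (1 - \<zeta>)" if "x' \<noteq> Target" for x'
    using assms that
    by (auto simp: pmf_map vimage_def measure_pmf_single Collect_b split: split_indicator)
  have "Target \<notin> set_spmf (product_transition M A (St u) y)"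
    by (auto simp: product_transition_def set_bind_spmf split: prod.splits if_splits)
  then have "AE x' in measure_spmf (product_transition M A (St u) y). x' \<noteq> Target"
    by (auto simp: AE_measure_spmf_iff)
  then have "spmf (augmented_transition M A \<zeta> (St u) y) Target =
      (\<integral>x'. indicat_real ?E x' * (1 - \<zeta>) \<partial>measure_spmf (product_transition M A (St u) y))"
    unfolding augmented_transition_def spmf_bind
    by (intro integral_cong_AE) (auto simp: step elim!: eventually_mono)
  then show ?thesis by simp
qed

definition augmented_mdp ::
  "('s, 'a, 'l) lmdp \<Rightarrow> ('l, 'q) buchi \<Rightarrow> real \<Rightarrow> (('s \<times> 'q) aug, 'a \<times> 'q) mdp" where
  "augmented_mdp M A \<zeta> =
     \<lparr>states = insert Target (states (product_mdp M A)),
      actions = actions (product_mdp M A),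
      start = start (product_mdp M A),
      avail = avail (product_mdp M A),
      transition = augmented_transition M A \<zeta>\<rparr>"

text \<open>\<open>Target\<close> is entered only by accepting transitions, so entering it earns the reward too.\<close>

definition augmented_rmdp ::
  "('s, 'a, 'l) lmdp \<Rightarrow> ('l, 'q) buchi \<Rightarrow> real \<Rightarrow> (('s \<times> 'q) aug, 'a \<times> 'q) rmdp" where
  "augmented_rmdp M A \<zeta> =
     \<lparr>states = states (augmented_mdp M A \<zeta>),
      actions = actions (augmented_mdp M A \<zeta>),
      start = start (augmented_mdp M A \<zeta>),
      avail = avail (augmented_mdp M A \<zeta>),
      transition = transition (augmented_mdp M A \<zeta>),
      reward = (\<lambda>x y x'. if x' = Target \<or> (x, y, x') \<in> accepting M A then 1 else 0)\<rparr>"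

end

theory Submission
  imports Defs
begin

text \<open>
  Let \<open>N\<close> be the number of accepting transitions of a run of the product, and \<open>N\<^sub>n\<close> the number among
  its first \<open>n\<close> steps. A run of the augmented MDP survives each of them with probability \<open>\<zeta>\<close>, so it
  avoids \<open>t\<close> with probability \<open>E[\<zeta> ^ N]\<close>, where \<open>\<zeta> ^ \<infinity> = 0\<close>; and \<open>(1 - \<zeta>) * reward - 1[t reached]\<close>
  is a martingale. This gives items 2 to 4.

  For item 5, let \<open>U(\<zeta>, x)\<close> be the infimum of \<open>E[\<zeta> ^ N]\<close> over all strategies from \<open>x\<close>, obtained by
  value iteration, and let \<open>Z(x)\<close> be its supremum over \<open>\<zeta>\<close>, which is its limit for \<open>\<zeta> \<rightarrow> 1\<close>. Since
  \<open>P(N = \<infinity>) \<le> 1 - E[\<zeta> ^ N]\<close>, no strategy satisfies the Buechi condition with probability above \<open>1 - Z\<close>.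
  There are finitely many state-action pairs, so for \<open>\<zeta>\<close> close to 1 every action that is optimal for
  \<open>U(\<zeta>, _)\<close> preserves \<open>Z\<close>. A strategy minimising \<open>E[\<zeta> ^ N]\<close> plays only such actions, because
  \<open>E[\<zeta> ^ N\<^sub>n * U(\<zeta>, x\<^sub>n)]\<close> is nondecreasing in \<open>n\<close> and bounded by its initial value. Hence
  \<open>E[Z(x\<^sub>n)] = Z(x\<^sub>0)\<close> for all \<open>n\<close>, while \<open>E[\<zeta> ^ N\<^sub>n * (1 - U(\<zeta>, x\<^sub>n))] \<rightarrow> 0\<close>. As \<open>1 - Z \<le> 1 - U(\<zeta>, _)\<close>,
  the value \<open>1 - Z(x\<^sub>0)\<close> is collected entirely on runs with \<open>N = \<infinity>\<close>.
\<close>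

section \<open>Finite prefixes of runs\<close>

text \<open>Entries may be \<open>None\<close>, so that a run that has stopped still has a prefix of
  every length.\<close>

definition run_prefix :: "nat \<Rightarrow> ('s, 'a) run \<Rightarrow> ('a \<times> 's) option list" where
  "run_prefix n \<omega> = map \<omega> [0..<n]"

definition next_pmf ::
  "('s, 'a, 'z) mdp_scheme \<Rightarrow> ('s, 'a) strategy \<Rightarrow> 's \<Rightarrow> ('a \<times> 's) option list \<Rightarrow> ('a \<times> 's) option pmf" where
  "next_pmf M f s xs =
     (if None \<in> set xs then return_pmf None else next_step M f (s, map the xs))"

text \<open>A discrete model of the first \<open>n\<close> steps. In a well-formed MDP its support
  is finite, so every real function is integrable; \<open>distr_prefix\<close> identifies it with
  the law of \<open>run_prefix n\<close>.\<close>

primrec prefix_pmf ::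
  "('s, 'a, 'z) mdp_scheme \<Rightarrow> ('s, 'a) strategy \<Rightarrow> 's \<Rightarrow> nat \<Rightarrow> ('a \<times> 's) option list pmf" where
  "prefix_pmf M f s 0 = return_pmf []"
| "prefix_pmf M f s (Suc n) =
     bind_pmf (prefix_pmf M f s n) (\<lambda>xs. map_pmf (\<lambda>y. xs @ [y]) (next_pmf M f s xs))"

text \<open>Finite supports turn both sides into finite sums, so \<open>h\<close> may be any real
  function.\<close>

lemma integral_bind_pmf_finite:
  fixes h :: "'b \<Rightarrow> real"
  assumes "finite (set_pmf p)" "\<And>x. x \<in> set_pmf p \<Longrightarrow> finite (set_pmf (q x))"
  shows "(\<integral>x. h x \<partial>bind_pmf p q) = (\<integral>x. (\<integral>y. h y \<partial>q x) \<partial>p)"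
  using assms
  by (subst pmf_expectation_bind[of "set_pmf p"])
    (auto simp: integral_measure_pmf[of "set_pmf p"])

lemma length_run_prefix [simp]: "length (run_prefix n \<omega>) = n"
  by (simp add: run_prefix_def)

lemma run_prefix_0 [simp]: "run_prefix 0 \<omega> = []"
  by (simp add: run_prefix_def)

lemma run_prefix_Suc: "run_prefix (Suc n) \<omega> = run_prefix n \<omega> @ [\<omega> n]"
  by (simp add: run_prefix_def)

lemma run_prefix_nth [simp]: "i < n \<Longrightarrow> run_prefix n \<omega> ! i = \<omega> i"
  by (simp add: run_prefix_def)

lemma run_prefix_cong: "(\<And>i. i < n \<Longrightarrow> \<omega> i = \<omega>' i) \<Longrightarrow> run_prefix n \<omega> = run_prefix n \<omega>'"
  by (simp add: run_prefix_def)

lemma length_prefix_pmf: "xs \<in> set_pmf (prefix_pmf M f s n) \<Longrightarrow> length xs = n"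
  by (induction n arbitrary: xs) auto

lemma step_kernel_eq:
  "step_kernel M f s i \<omega> = restrict_space (measure_pmf (next_pmf M f s (run_prefix i \<omega>))) (steps M)"
proof -
  have *: "(\<forall>j<i. \<omega> j \<noteq> None) \<longleftrightarrow> None \<notin> set (run_prefix i \<omega>)"
    by (simp add: run_prefix_def image_iff Ball_def eq_commute[of None] del: not_None_eq)
  show ?thesis
    unfolding step_kernel_def next_pmf_def * by (simp add: run_prefix_def)
qed

section \<open>The law of finite prefixes under the run measure\<close>

text \<open>The assumption is \<open>well_formed\<close> rather than \<open>labelled_mdp\<close>, so
  that the product, whose transitions may lose mass, and the augmented MDP are both covered.\<close>

locale finite_mdp =
  fixes M :: "('s, 'a, 'z) mdp_scheme"
  assumes well_formed: "well_formed M"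

locale strategy_run = finite_mdp M
  for M :: "('s, 'a, 'z) mdp_scheme" +
  fixes f :: "('s, 'a) strategy" and s :: 's
  assumes strategy: "f \<in> strategies M"
    and start_in: "s \<in> states M"
begin

abbreviation "R \<equiv> run_measure M f s"
abbreviation "D n \<equiv> prefix_pmf M f s n"
abbreviation "K xs \<equiv> next_pmf M f s xs"
abbreviation "N \<equiv> \<lambda>_::nat. count_space (steps M)"

sublocale IT: Ionescu_Tulcea "step_kernel M f s" N
  using well_formed strategy by (rule Ionescu_Tulcea_step_kernel)

lemma finite_steps: "finite (steps M)"
  using well_formed by (auto simp: steps_def well_formed_def)

lemma set_next_pmf: "set_pmf (K xs) \<subseteq> steps M"
  using set_next_step[OF well_formed strategy] by (auto simp: next_pmf_def steps_def)

lemma finite_next_pmf: "finite (set_pmf (K xs))"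
  using set_next_pmf finite_steps by (rule finite_subset)

lemma finite_prefix_pmf: "finite (set_pmf (D n))"
  by (induction n) (auto simp: finite_next_pmf)

lemma run_measure_eq: "R = IT.PF.lim"
  by (simp add: run_measure_def)

lemma sets_run: "sets R = sets (PiM UNIV N)"
  unfolding run_measure_eq by simp

lemma run_prefix_measurable: "run_prefix n \<in> measurable (PiM UNIV N) (count_space UNIV)"
proof (induction n)
  case (Suc n)
  have "(\<lambda>\<omega>. run_prefix n \<omega> @ [\<omega> n]) \<in> measurable (PiM UNIV N) (count_space UNIV)"
  proof (rule measurable_compose_countable'[where I = "steps M" and g = "\<lambda>\<omega>. \<omega> n" and f = "\<lambda>y \<omega>. run_prefix n \<omega> @ [y]"])
    show "(\<lambda>\<omega>. \<omega> n) \<in> measurable (PiM UNIV N) (count_space (steps M))"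
      by measurable
    show "countable (steps M)" using finite_steps by (rule countable_finite)
    show "(\<lambda>\<omega>. run_prefix n \<omega> @ [y]) \<in> measurable (PiM UNIV N) (count_space UNIV)" for y
      using Suc by (rule measurable_compose) simp
  qed
  then show ?case by (simp add: run_prefix_Suc[abs_def])
qed (simp add: run_prefix_def)

lemma run_prefix_measurable_run [measurable]: "run_prefix n \<in> measurable R (count_space UNIV)"
  using run_prefix_measurable by (simp add: measurable_cong_sets[OF sets_run refl])

lemma run_prefix_measurable_Ico: "run_prefix n \<in> measurable (PiM {0..<n} N) (count_space UNIV)"
  by (subst count_space_PiM_finite) (auto simp: finite_steps countable_finite)

lemma measurable_restrict_run: "(\<lambda>\<omega>. restrict \<omega> {0..<n}) \<in> measurable R (PiM {0..<n} N)"
  by (simp add: measurable_cong_sets[OF sets_run refl] measurable_restrict)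

text \<open>The marginal of the Ionescu-Tulcea limit on the first \<open>n\<close> coordinates is
  the composition of the first \<open>n\<close> step kernels, started at
  \<open>\<lambda>_. undefined\<close>, the only point of the product over the empty index
  set.\<close>

lemma distr_run: "distr R (PiM {0..<n} N) (\<lambda>\<omega>. restrict \<omega> {0..<n}) = IT.C 0 n (\<lambda>_. undefined)"
proof -
  \<comment> \<open>\<open>IT.CI\<close> composes kernels up to \<open>IT.up_to\<close> of the index
    set and then projects; for an initial segment the projection discards nothing.\<close>
  have "IT.up_to {0..<n} = n"
    using IT.up_to[of "{0..<n}"] by (intro antisym) (auto simp: IT.up_to_iff)
  then show ?thesis
    unfolding run_measure_eq using IT.distr_C[of n n "\<lambda>_. undefined" 0]
    by (simp add: IT.distr_lim IT.CI_def)
qed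

text \<open>A push-forward has the same total mass, so the projection onto no coordinates already
  decides it.\<close>

lemma prob_space_run: "prob_space R"
proof (rule prob_space_distrD[OF measurable_restrict_run[of 0]])
  show "prob_space (distr R (PiM {0..<0} N) (\<lambda>\<omega>. restrict \<omega> {0..<0}))"
    unfolding distr_run by (rule IT.prob_space_C) simp
qed

text \<open>Induction on \<open>n\<close>: \<open>IT.eP n\<close> appends one coordinate drawn from
  \<open>step_kernel\<close>, which depends on the run only through its prefix and, up to the
  restriction to \<open>steps M\<close>, is \<open>next_pmf\<close>.\<close>

lemma nn_integral_C_prefix:
  "(\<integral>\<^sup>+\<omega>. F (run_prefix n \<omega>) \<partial>IT.C 0 n (\<lambda>_. undefined)) = (\<integral>\<^sup>+xs. F xs \<partial>D n)"
proof (induction n arbitrary: F)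
  case 0
  show ?case by (simp add: nn_integral_return)
next
  case (Suc n)
  have m: "(\<lambda>\<omega>. F (run_prefix k \<omega>)) \<in> borel_measurable (PiM {0..<k} N)" for k and F :: "_ \<Rightarrow> ennreal"
    by (rule measurable_compose[OF run_prefix_measurable_Ico]) simp
  have u: "(\<lambda>_. undefined) \<in> space (PiM {0..<0::nat} N)"
    by (simp add: space_PiM)
  have sp: "space (IT.C 0 n (\<lambda>_. undefined)) = space (PiM {0..<n} N)"
    using IT.space_C[OF u, of n] by simp
  have ms: "sets (IT.C 0 n (\<lambda>_. undefined)) = sets (PiM {0..<n} N)"
    using IT.sets_C[OF u, of n] by simp
  have "(\<integral>\<^sup>+\<omega>. F (run_prefix (Suc n) \<omega>) \<partial>IT.C 0 (Suc n) (\<lambda>_. undefined)) =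
     (\<integral>\<^sup>+\<omega>. \<integral>\<^sup>+\<omega>'. F (run_prefix (Suc n) \<omega>') \<partial>IT.eP n \<omega> \<partial>IT.C 0 n (\<lambda>_. undefined))"
    using m[of F "Suc n"] IT.measurable_eP[of n]
    by (simp add: nn_integral_bind[where B = "PiM {0..<Suc n} N"] measurable_cong_sets[OF ms refl])
  also have "\<dots> = (\<integral>\<^sup>+\<omega>. (\<integral>\<^sup>+y. F (run_prefix n \<omega> @ [y]) \<partial>K (run_prefix n \<omega>)) \<partial>IT.C 0 n (\<lambda>_. undefined))"
  proof (rule nn_integral_cong)
    fix \<omega> assume "\<omega> \<in> space (IT.C 0 n (\<lambda>_. undefined))"
    then have w: "\<omega> \<in> space (PiM {0..<n} N)" by (simp add: sp)
    have "(\<integral>\<^sup>+\<omega>'. F (run_prefix (Suc n) \<omega>') \<partial>IT.eP n \<omega>) =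
        (\<integral>\<^sup>+y. F (run_prefix (Suc n) (fun_upd \<omega> n y)) \<partial>step_kernel M f s n \<omega>)"
      using w m by (rule IT.nn_integral_eP)
    also have "\<dots> = (\<integral>\<^sup>+y. F (run_prefix n \<omega> @ [y]) \<partial>step_kernel M f s n \<omega>)"
      using run_prefix_cong[of n \<omega> "fun_upd \<omega> n y" for y] by (simp add: run_prefix_Suc)
    also have "\<dots> = (\<integral>\<^sup>+y. F (run_prefix n \<omega> @ [y]) * indicator (steps M) y \<partial>K (run_prefix n \<omega>))"
      unfolding step_kernel_eq by (subst nn_integral_restrict_space) auto
    also have "\<dots> = (\<integral>\<^sup>+y. F (run_prefix n \<omega> @ [y]) \<partial>K (run_prefix n \<omega>))"
      using set_next_pmf by (intro nn_integral_cong_AE) (auto simp: AE_measure_pmf_iff indicator_def)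
    finally show "(\<integral>\<^sup>+\<omega>'. F (run_prefix (Suc n) \<omega>') \<partial>IT.eP n \<omega>) = (\<integral>\<^sup>+y. F (run_prefix n \<omega> @ [y]) \<partial>K (run_prefix n \<omega>))" .
  qed
  also have "\<dots> = (\<integral>\<^sup>+xs. \<integral>\<^sup>+y. F (xs @ [y]) \<partial>K xs \<partial>D n)"
    by (rule Suc)
  also have "\<dots> = (\<integral>\<^sup>+xs. F xs \<partial>D (Suc n))"
    by simp
  finally show ?case .
qed

text \<open>The passage from infinite runs to finite prefixes: an integrand that reads
  \<open>n\<close> steps sees only the marginal on \<open>{0..<n}\<close>.\<close>

lemma nn_integral_prefix: "(\<integral>\<^sup>+\<omega>. F (run_prefix n \<omega>) \<partial>R) = (\<integral>\<^sup>+xs. F xs \<partial>D n)"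
proof -
  have m: "(\<lambda>\<omega>. F (run_prefix n \<omega>)) \<in> borel_measurable (PiM {0..<n} N)"
    by (rule measurable_compose[OF run_prefix_measurable_Ico]) simp
  have "(\<integral>\<^sup>+\<omega>. F (run_prefix n \<omega>) \<partial>R) = (\<integral>\<^sup>+\<omega>. F (run_prefix n (restrict \<omega> {0..<n})) \<partial>R)"
    by (intro nn_integral_cong arg_cong[where f = F] run_prefix_cong) simp
  also have "\<dots> = (\<integral>\<^sup>+\<omega>. F (run_prefix n \<omega>) \<partial>distr R (PiM {0..<n} N) (\<lambda>\<omega>. restrict \<omega> {0..<n}))"
    using m by (simp add: nn_integral_distr[OF measurable_restrict_run])
  finally show ?thesis
    by (simp add: distr_run nn_integral_C_prefix)
qed

lemma distr_prefix: "distr R (count_space UNIV) (run_prefix n) = measure_pmf (D n)"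
proof (rule measure_eqI)
  fix X assume "X \<in> sets (distr R (count_space UNIV) (run_prefix n))"
  have "(\<integral>\<^sup>+xs. indicator X xs \<partial>distr R (count_space UNIV) (run_prefix n)) = (\<integral>\<^sup>+\<omega>. indicator X (run_prefix n \<omega>) \<partial>R)"
    by (rule nn_integral_distr) auto
  then show "emeasure (distr R (count_space UNIV) (run_prefix n)) X = emeasure (measure_pmf (D n)) X"
    by (simp add: nn_integral_prefix[of "indicator X"])
qed simp

lemma integral_prefix:
  fixes F :: "_ \<Rightarrow> real"
  shows "(\<integral>\<omega>. F (run_prefix n \<omega>) \<partial>R) = (\<integral>xs. F xs \<partial>D n)"
proof -
  have "(\<integral>xs. F xs \<partial>distr R (count_space UNIV) (run_prefix n)) = (\<integral>\<omega>. F (run_prefix n \<omega>) \<partial>R)"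
    by (rule integral_distr) auto
  then show ?thesis
    by (simp add: distr_prefix)
qed

lemma integrable_prefix:
  fixes F :: "_ \<Rightarrow> real"
  shows "integrable (D n) F"
  by (rule integrable_measure_pmf_finite) (rule finite_prefix_pmf)

lemma prob_prefix: "\<P>(\<omega> in R. Q (run_prefix n \<omega>)) = measure (D n) {xs. Q xs}"
proof -
  have "measure (distr R (count_space UNIV) (run_prefix n)) {xs. Q xs} = measure R (run_prefix n -` {xs. Q xs} \<inter> space R)"
    by (rule measure_distr) auto
  then show ?thesis
    by (simp add: distr_prefix vimage_def Int_def conj_commute)
qed

lemma integral_prefix_Suc:
  fixes F :: "_ \<Rightarrow> real"
  shows "(\<integral>xs. F xs \<partial>D (Suc n)) = (\<integral>xs. (\<integral>y. F (xs @ [y]) \<partial>K xs) \<partial>D n)"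
  by (simp add: integral_bind_pmf_finite finite_prefix_pmf finite_next_pmf)

end

section \<open>Counting accepting transitions\<close>

text \<open>Padding with \<open>None\<close> makes a prefix a run, so that \<open>takes\<close>
  applies to it unchanged.\<close>

definition list_run :: "('a \<times> 's) option list \<Rightarrow> ('s, 'a) run" where
  "list_run xs = (\<lambda>i. if i < length xs then xs ! i else None)"

definition hits :: "('s \<times> 'a \<times> 's) set \<Rightarrow> 's \<Rightarrow> ('a \<times> 's) option list \<Rightarrow> nat" where
  "hits E s xs = card {i. i < length xs \<and> takes E s (list_run xs) i}"

lemma takes_cong: "(\<And>j. j \<le> i \<Longrightarrow> \<omega> j = \<omega>' j) \<Longrightarrow> takes E s \<omega> i = takes E s \<omega>' i"
  by (auto simp: takes_def triple_at_def state_at_def split: nat.splits)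

lemma takes_list_run_prefix: "i < n \<Longrightarrow> takes E s (list_run (run_prefix n \<omega>)) i = takes E s \<omega> i"
  by (rule takes_cong) (simp add: list_run_def)

lemma hits_run_prefix: "hits E s (run_prefix n \<omega>) = card {i. i < n \<and> takes E s \<omega> i}"
  by (auto simp: hits_def takes_list_run_prefix intro!: arg_cong[where f = card])

lemma hits_Nil [simp]: "hits E s [] = 0"
  by (simp add: hits_def)

lemma hits_snoc:
  "hits E s (xs @ [y]) =
     hits E s xs + (if takes E s (list_run (xs @ [y])) (length xs) then 1 else 0)"
proof -
  have "takes E s (list_run (xs @ [y])) i = takes E s (list_run xs) i" if "i < length xs" for i
    using that by (intro takes_cong) (simp add: list_run_def nth_append)
  then have "{i. i < length (xs @ [y]) \<and> takes E s (list_run (xs @ [y])) i} =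
      {i. i < length xs \<and> takes E s (list_run xs) i} \<union>
      (if takes E s (list_run (xs @ [y])) (length xs) then {length xs} else {})"
    by (auto simp: less_Suc_eq)
  then show ?thesis
    by (simp add: hits_def)
qed

lemma hits_snoc_None: "hits E s (xs @ [None]) = hits E s xs"
  by (simp add: hits_snoc takes_def triple_at_def list_run_def split: option.split)

lemma state_at_list_run:
  "None \<notin> set xs \<Longrightarrow> state_at s (list_run (xs @ ys)) (length xs) = Some (last_state (s, map the xs))"
proof (cases xs rule: rev_cases)
  case (snoc zs y)
  moreover assume "None \<notin> set xs"
  ultimately show ?thesis
    by (cases y) (auto simp: state_at_def list_run_def nth_append)
qed (simp add: state_at_def)

lemma triple_at_list_run:
  "None \<notin> set xs \<Longrightarrow>
     triple_at s (list_run (xs @ [Some (a, x)])) (length xs) = Some (last_state (s, map the xs), a, x)"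
  by (simp add: triple_at_def state_at_list_run del: last_state.simps) (simp add: list_run_def)

lemma hits_snoc_Some:
  "None \<notin> set xs \<Longrightarrow>
     hits E s (xs @ [Some (a, x)]) =
       hits E s xs + (if (last_state (s, map the xs), a, x) \<in> E then 1 else 0)"
  by (simp add: hits_snoc takes_def triple_at_list_run del: last_state.simps)

text \<open>The infinite case is separate because \<open>card\<close> of an infinite set is 0, which
  would give the value 1 instead of 0.\<close>

definition discount :: "('s \<times> 'a \<times> 's) set \<Rightarrow> 's \<Rightarrow> real \<Rightarrow> ('s, 'a) run \<Rightarrow> real" where
  "discount E s \<zeta> \<omega> = (if \<exists>\<^sub>\<infinity>i. takes E s \<omega> i then 0 else \<zeta> ^ card {i. takes E s \<omega> i})"

text \<open>For the product and its accepting transitions this is the probability that the augmented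
  MDP never reaches \<open>Target\<close>; see \<open>prob_reach_augmented\<close>.\<close>

definition escape ::
  "('s, 'a, 'z) mdp_scheme \<Rightarrow> ('s \<times> 'a \<times> 's) set \<Rightarrow> real \<Rightarrow> 's \<Rightarrow> ('s, 'a) strategy \<Rightarrow> real" where
  "escape M E \<zeta> s f = (\<integral>\<omega>. discount E s \<zeta> \<omega> \<partial>run_measure M f s)"

lemma integral_pmf_eq_0D:
  fixes h :: "'b \<Rightarrow> real"
  assumes "finite (set_pmf p)" "(\<integral>x. h x \<partial>measure_pmf p) = 0"
    and "\<And>x. x \<in> set_pmf p \<Longrightarrow> 0 \<le> h x" "x \<in> set_pmf p"
  shows "h x = 0"
proof -
  have "AE x in measure_pmf p. 0 \<le> h x"
    using assms(3) by (simp add: AE_measure_pmf_iff)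
  with assms(2) have "AE x in measure_pmf p. h x = 0"
    by (subst (asm) integral_nonneg_eq_0_iff_AE) (auto intro: integrable_measure_pmf_finite assms(1))
  with assms(4) show ?thesis by (simp add: AE_measure_pmf_iff)
qed

text \<open>
  These values are costs, to be minimised. A stopped run costs \<open>\<zeta> ^ 0 = 1\<close>: no accepting transition
  follows.
\<close>

definition end_value :: "('s \<Rightarrow> real) \<Rightarrow> 's \<Rightarrow> ('a \<times> 's) option list \<Rightarrow> real" where
  "end_value u s xs = (if None \<in> set xs then 1 else u (last_state (s, map the xs)))"

text \<open>The Bellman operator of the minimisation problem: only transitions in \<open>E\<close>
  are discounted, and lost mass is charged the cost 1.\<close>

definition action_value ::
  "('s, 'a, 'z) mdp_scheme \<Rightarrow> ('s \<times> 'a \<times> 's) set \<Rightarrow> real \<Rightarrow> ('s \<Rightarrow> real) \<Rightarrow> 's \<Rightarrow> 'a \<Rightarrow> real" where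
  "action_value M E \<zeta> u x a =
     (\<integral>z. (case z of None \<Rightarrow> 1 | Some x' \<Rightarrow> (if (x, a, x') \<in> E then \<zeta> else 1) * u x') \<partial>measure_pmf (transition M x a))"

lemma end_value_Nil [simp]: "end_value u s [] = u s"
  by (simp add: end_value_def)

lemma end_value_snoc:
  "None \<notin> set xs \<Longrightarrow> end_value u s (xs @ [y]) = (case y of None \<Rightarrow> 1 | Some (a, x) \<Rightarrow> u x)"
  by (auto simp: end_value_def split: option.split)

context finite_mdp
begin

lemma last_state_in: "r \<in> decision_runs M \<Longrightarrow> last_state r \<in> states M"
  using last_state_in_states[OF well_formed] by (auto simp: decision_runs_def)

lemma finite_avail: "x \<in> states M \<Longrightarrow> finite (avail M x)"
  using well_formed by (auto simp: well_formed_def intro: finite_subset)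

lemma set_transition:
  "x \<in> states M \<Longrightarrow> a \<in> avail M x \<Longrightarrow> set_pmf (transition M x a) \<subseteq> insert None (Some ` states M)"
proof
  fix z assume "x \<in> states M" "a \<in> avail M x" and z: "z \<in> set_pmf (transition M x a)"
  then have *: "set_spmf (transition M x a) \<subseteq> states M"
    using well_formed unfolding well_formed_def by blast
  show "z \<in> insert None (Some ` states M)"
    using * z by (cases z) (auto simp: in_set_spmf[symmetric])
qed

lemma finite_transition:
  "x \<in> states M \<Longrightarrow> a \<in> avail M x \<Longrightarrow> finite (set_pmf (transition M x a))"
  using well_formed by (intro finite_subset[OF set_transition]) (auto simp: well_formed_def)

end

context strategy_run
begin

lemma set_strategy: "r \<in> decision_runs M \<Longrightarrow> set_pmf (f r) \<subseteq> avail M (last_state r)"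
  using strategy by (auto simp: strategies_def PiE_iff)

lemma finite_strategy: "r \<in> decision_runs M \<Longrightarrow> finite (set_pmf (f r))"
  using set_strategy finite_avail last_state_in finite_subset by blast

lemma is_path_snoc:
  "is_path M x (ys @ [(a, x')]) \<longleftrightarrow>
     is_path M x ys \<and> a \<in> avail M (last_state (x, ys)) \<and>
     spmf (transition M (last_state (x, ys)) a) x' > 0 \<and> x' \<in> states M"
  by (induction ys arbitrary: x) auto

text \<open>Ensures that the last state of a possible prefix is a state of \<open>M\<close>, and
  that an unstopped prefix fails to be a decision run only for lack of available actions.\<close>

lemma finite_run_prefix:
  "xs \<in> set_pmf (D n) \<Longrightarrow> None \<notin> set xs \<Longrightarrow> (s, map the xs) \<in> finite_runs M"
proof (induction n arbitrary: xs)
  case 0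
  then show ?case using start_in by (simp add: finite_runs_def)
next
  case (Suc n)
  then obtain xs' y where xs: "xs = xs' @ [y]" "xs' \<in> set_pmf (D n)" "y \<in> set_pmf (K xs')"
    by auto
  from xs Suc.prems have nn: "None \<notin> set xs'" "y \<noteq> None"
    by (cases y; auto)+
  let ?r = "(s, map the xs')"
  have y: "y \<in> set_pmf (next_step M f ?r)" using xs(3) nn by (simp add: next_pmf_def)
  then have r: "?r \<in> decision_runs M" using nn by (auto simp: next_step_def split: if_splits)
  with y nn obtain a x' where ax: "a \<in> set_pmf (f ?r)" "Some x' \<in> set_pmf (transition M (last_state ?r) a)"
      "y = Some (a, x')"
    by (auto simp: next_step_def simp del: last_state.simps)
  have a: "a \<in> avail M (last_state ?r)" using set_strategy[OF r] ax by auto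
  then have "x' \<in> states M" using set_transition[OF last_state_in[OF r] a] ax by auto
  moreover have "spmf (transition M (last_state ?r) a) x' > 0"
    using ax by (simp add: pmf_positive del: last_state.simps)
  ultimately show ?case
    using Suc.IH[OF xs(2) nn(1)] a ax
    by (simp add: xs finite_runs_def is_path_snoc del: last_state.simps)
qed

end

section \<open>Expected discounted costs along prefixes\<close>

locale buchi_run = strategy_run M f s
  for M :: "('s, 'a, 'z) mdp_scheme" and f and s +
  fixes E :: "('s \<times> 'a \<times> 's) set"
begin

abbreviation "H xs \<equiv> hits E s xs"
abbreviation "Q \<zeta> u x a \<equiv> action_value M E \<zeta> u x a"
abbreviation "V u xs \<equiv> end_value u s xs"

text \<open>The expected cost one step later, with the discount of the past hits taken out as a
  factor.\<close>

definition step_value :: "real \<Rightarrow> ('s \<Rightarrow> real) \<Rightarrow> ('a \<times> 's) option list \<Rightarrow> real" where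
  "step_value \<zeta> u xs =
     (if None \<in> set xs \<or> (s, map the xs) \<notin> decision_runs M then 1
      else \<integral>a. Q \<zeta> u (last_state (s, map the xs)) a \<partial>f (s, map the xs))"

text \<open>With \<open>u\<close> constantly 1 this is the expectation of
  \<open>\<zeta> ^ H\<close>; with \<open>\<zeta> = 1\<close> it is the expectation of
  \<open>u\<close> after \<open>n\<close> steps, where stopped runs count 1.\<close>

definition stage_value :: "nat \<Rightarrow> real \<Rightarrow> ('s \<Rightarrow> real) \<Rightarrow> real" where
  "stage_value n \<zeta> u = (\<integral>xs. \<zeta> ^ H xs * V u xs \<partial>D n)"

lemma step_value:
  "(\<integral>y. \<zeta> ^ H (xs @ [y]) * V u (xs @ [y]) \<partial>K xs) = \<zeta> ^ H xs * step_value \<zeta> u xs"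
proof (cases "None \<in> set xs \<or> (s, map the xs) \<notin> decision_runs M")
  case True
  then have "K xs = return_pmf None"
    by (auto simp: next_pmf_def next_step_def)
  with True show ?thesis
    by (simp add: step_value_def hits_snoc_None end_value_def)
next
  case False
  let ?r = "(s, map the xs)"
  let ?x = "last_state ?r"
  from False have nn: "None \<notin> set xs" and r: "?r \<in> decision_runs M" by auto
  have K: "K xs = bind_pmf (f ?r) (\<lambda>a. map_spmf (Pair a) (transition M ?x a))"
    using nn r by (simp add: next_pmf_def next_step_def del: last_state.simps)
  have fin: "finite (set_pmf (transition M ?x a))" if "a \<in> set_pmf (f ?r)" for a
    using that finite_transition[OF last_state_in[OF r]] set_strategy[OF r] by blast
  have "(\<integral>y. \<zeta> ^ H (xs @ [y]) * V u (xs @ [y]) \<partial>K xs) =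
      (\<integral>a. (\<integral>z. \<zeta> ^ H (xs @ [map_option (Pair a) z]) * V u (xs @ [map_option (Pair a) z]) \<partial>measure_pmf (transition M ?x a)) \<partial>f ?r)"
    unfolding K using fin by (subst integral_bind_pmf_finite) (auto simp: finite_strategy[OF r] simp del: last_state.simps)
  also have "\<dots> = (\<integral>a. \<zeta> ^ H xs * Q \<zeta> u ?x a \<partial>f ?r)"
  proof (rule Bochner_Integration.integral_cong[OF refl])
    fix a
    have "\<zeta> ^ H (xs @ [map_option (Pair a) z]) * V u (xs @ [map_option (Pair a) z]) =
        \<zeta> ^ H xs * (case z of None \<Rightarrow> 1 | Some x' \<Rightarrow> (if (?x, a, x') \<in> E then \<zeta> else 1) * u x')" for z
      using nn by (cases z) (simp_all add: end_value_snoc hits_snoc_None hits_snoc_Some del: last_state.simps)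
    then show "(\<integral>z. \<zeta> ^ H (xs @ [map_option (Pair a) z]) * V u (xs @ [map_option (Pair a) z]) \<partial>measure_pmf (transition M ?x a)) =
        \<zeta> ^ H xs * Q \<zeta> u ?x a"
      by (simp add: action_value_def del: last_state.simps)
  qed
  finally show ?thesis
    using nn r by (simp add: step_value_def del: last_state.simps)
qed

lemma stage_value_0 [simp]: "stage_value 0 \<zeta> u = u s"
  by (simp add: stage_value_def)

lemma stage_value_Suc: "stage_value (Suc n) \<zeta> u = (\<integral>xs. \<zeta> ^ H xs * step_value \<zeta> u xs \<partial>D n)"
  unfolding stage_value_def integral_prefix_Suc step_value ..

text \<open>Serves both the greedy strategy, where \<open>u'\<close> has one more step to go than
  \<open>u\<close>, and \<open>limit_value\<close>, where \<open>u'\<close> is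
  \<open>u\<close>.\<close>

lemma stage_value_Suc_eq:
  assumes "\<And>xs. xs \<in> set_pmf (D n) \<Longrightarrow> step_value \<zeta> u xs = V u' xs"
  shows "stage_value (Suc n) \<zeta> u = stage_value n \<zeta> u'"
  unfolding stage_value_Suc unfolding stage_value_def
  by (intro integral_cong_AE) (auto simp: AE_measure_pmf_iff assms)

lemma end_value_cases:
  assumes "xs \<in> set_pmf (D n)"
  obtains (stopped) "None \<in> set xs" "V u xs = 1" "step_value \<zeta> u xs = 1"
  | (final) "None \<notin> set xs" "last_state (s, map the xs) \<in> states M" "avail M (last_state (s, map the xs)) = {}"
      "V u xs = u (last_state (s, map the xs))" "step_value \<zeta> u xs = 1"
  | (moving) "None \<notin> set xs" "(s, map the xs) \<in> decision_runs M" "last_state (s, map the xs) \<in> states M"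
      "V u xs = u (last_state (s, map the xs))"
      "step_value \<zeta> u xs = (\<integral>a. Q \<zeta> u (last_state (s, map the xs)) a \<partial>f (s, map the xs))"
proof -
  consider "None \<in> set xs" | "None \<notin> set xs" "(s, map the xs) \<in> decision_runs M"
    | "None \<notin> set xs" "(s, map the xs) \<notin> decision_runs M" by blast
  then show ?thesis
  proof cases
    case 1
    then show ?thesis by (intro stopped) (auto simp: end_value_def step_value_def)
  next
    case 2
    then show ?thesis
      by (intro moving last_state_in) (auto simp: end_value_def step_value_def simp del: last_state.simps)
  next
    case 3
    with finite_run_prefix[OF assms] have "(s, map the xs) \<in> finite_runs M" by simp
    with 3 last_state_in_states[OF well_formed this] show ?thesis
      by (intro final) (auto simp: end_value_def step_value_def decision_runs_def simp del: last_state.simps)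
  qed
qed

text \<open>The bound by 1 handles states without actions, where the run stops at cost 1. Elsewhere
  a lower bound for every available action bounds the average over the strategy's choice.\<close>

lemma end_value_le_step_value:
  assumes u1: "\<And>x. x \<in> states M \<Longrightarrow> u x \<le> 1"
    and uQ: "\<And>x a. x \<in> states M \<Longrightarrow> a \<in> avail M x \<Longrightarrow> u x \<le> Q \<zeta> u x a"
    and xs: "xs \<in> set_pmf (D n)"
  shows "V u xs \<le> step_value \<zeta> u xs"
  using xs
proof (cases rule: end_value_cases[of xs n u \<zeta>])
  case moving
  let ?r = "(s, map the xs)"
  have "u (last_state ?r) \<le> (\<integral>a. Q \<zeta> u (last_state ?r) a \<partial>f ?r)"
  proof (rule measure_pmf.integral_ge_const)
    show "integrable (measure_pmf (f ?r)) (\<lambda>a. Q \<zeta> u (last_state ?r) a)"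
      by (rule integrable_measure_pmf_finite) (rule finite_strategy[OF moving(2)])
    show "AE a in measure_pmf (f ?r). u (last_state ?r) \<le> Q \<zeta> u (last_state ?r) a"
      using uQ[OF moving(3)] set_strategy[OF moving(2)] by (auto simp: AE_measure_pmf_iff simp del: last_state.simps)
  qed
  with moving show ?thesis by simp
qed (auto simp: u1)

text \<open>The submartingale property: a function below its own Bellman backup has nondecreasing
  discounted expectations, whatever the strategy.\<close>

lemma stage_value_mono:
  assumes "\<And>x. x \<in> states M \<Longrightarrow> u x \<le> 1"
    and "\<And>x a. x \<in> states M \<Longrightarrow> a \<in> avail M x \<Longrightarrow> u x \<le> Q \<zeta> u x a"
    and "0 \<le> \<zeta>"
  shows "stage_value n \<zeta> u \<le> stage_value (Suc n) \<zeta> u"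
  unfolding stage_value_Suc unfolding stage_value_def
  using assms
  by (intro integral_mono_AE integrable_prefix)
    (auto simp: AE_measure_pmf_iff intro!: mult_left_mono end_value_le_step_value)

lemma stage_value_mono_fun:
  assumes "\<And>x. x \<in> states M \<Longrightarrow> u x \<le> u' x" "0 \<le> \<zeta>"
  shows "stage_value n \<zeta> u \<le> stage_value n \<zeta> u'"
  unfolding stage_value_def
proof (intro integral_mono_AE integrable_prefix, unfold AE_measure_pmf_iff, rule ballI)
  fix xs assume xs: "xs \<in> set_pmf (D n)"
  have "V u xs \<le> V u' xs"
    using assms(1) last_state_in_states[OF well_formed finite_run_prefix[OF xs]]
    by (simp add: end_value_def del: last_state.simps)
  then show "\<zeta> ^ H xs * V u xs \<le> \<zeta> ^ H xs * V u' xs"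
    using assms(2) by (intro mult_left_mono) auto
qed

text \<open>If the submartingale does not grow in a step, then every action played in that step with
  positive probability is tight.\<close>

lemma stage_value_tight:
  assumes u1: "\<And>x. x \<in> states M \<Longrightarrow> u x \<le> 1"
    and uQ: "\<And>x a. x \<in> states M \<Longrightarrow> a \<in> avail M x \<Longrightarrow> u x \<le> Q \<zeta> u x a"
    and "0 < \<zeta>"
    and eq: "stage_value (Suc n) \<zeta> u = stage_value n \<zeta> u"
    and xs: "xs \<in> set_pmf (D n)" "None \<notin> set xs" "(s, map the xs) \<in> decision_runs M"
    and a: "a \<in> set_pmf (f (s, map the xs))"
  shows "Q \<zeta> u (last_state (s, map the xs)) a = u (last_state (s, map the xs))"
proof -
  let ?r = "(s, map the xs)"
  let ?x = "last_state ?r"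
  have "(\<integral>xs. \<zeta> ^ H xs * (step_value \<zeta> u xs - V u xs) \<partial>D n) = 0"
    using eq unfolding stage_value_Suc unfolding stage_value_def
    by (simp add: right_diff_distrib integrable_prefix)
  \<comment> \<open>A nonnegative integrand with integral 0 vanishes at every prefix of positive
    probability; \<open>0 < \<zeta>\<close> then cancels the power.\<close>
  then have "\<zeta> ^ H xs * (step_value \<zeta> u xs - V u xs) = 0"
  proof (rule integral_pmf_eq_0D[OF finite_prefix_pmf _ _ xs(1)])
    show "0 \<le> \<zeta> ^ H ys * (step_value \<zeta> u ys - V u ys)" if "ys \<in> set_pmf (D n)" for ys
      using end_value_le_step_value[OF u1 uQ that] \<open>0 < \<zeta>\<close> by simp
  qed
  then have "step_value \<zeta> u xs = V u xs"
    using \<open>0 < \<zeta>\<close> by simp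
  then have Q: "(\<integral>a. Q \<zeta> u ?x a \<partial>f ?r) = u ?x"
    using xs by (simp add: step_value_def end_value_def del: last_state.simps)
  have i: "integrable (measure_pmf (f ?r)) g" for g :: "_ \<Rightarrow> real"
    by (rule integrable_measure_pmf_finite) (rule finite_strategy[OF xs(3)])
  \<comment> \<open>The same argument again, now for the distribution over actions.\<close>
  have "(\<integral>a. Q \<zeta> u ?x a - u ?x \<partial>f ?r) = 0"
    using Q by (simp add: i del: last_state.simps)
  then have "Q \<zeta> u ?x a - u ?x = 0"
  proof (rule integral_pmf_eq_0D[OF finite_strategy[OF xs(3)] _ _ a])
    show "0 \<le> Q \<zeta> u ?x b - u ?x" if "b \<in> set_pmf (f ?r)" for b
      using uQ[OF last_state_in[OF xs(3)], of b] set_strategy[OF xs(3)] that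
      by (auto simp del: last_state.simps)
  qed
  then show ?thesis by simp
qed

section \<open>The discount of infinite runs and the Buechi probability\<close>

lemma takes_measurable [measurable]: "Measurable.pred R (\<lambda>\<omega>. takes E s \<omega> i)"
proof -
  have "Measurable.pred R (\<lambda>\<omega>. takes E s (list_run (run_prefix (Suc i) \<omega>)) i)"
    by (rule measurable_compose[OF run_prefix_measurable_run]) simp
  then show ?thesis by (simp add: takes_list_run_prefix)
qed

lemma hits_mono: "m \<le> n \<Longrightarrow> H (run_prefix m \<omega>) \<le> H (run_prefix n \<omega>)"
  by (auto simp: hits_run_prefix intro!: card_mono)

text \<open>Expresses the Buechi event through finite prefixes, which gives its measurability and
  its approximation by the events of at least \<open>k\<close> hits.\<close>

lemma infinitely_many_hits:
  "(\<exists>\<^sub>\<infinity>i. takes E s \<omega> i) \<longleftrightarrow> (\<forall>k. \<exists>n. k \<le> H (run_prefix n \<omega>))"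
proof
  assume "\<exists>\<^sub>\<infinity>i. takes E s \<omega> i"
  then have inf: "infinite {i. takes E s \<omega> i}" by (simp add: INFM_iff_infinite)
  show "\<forall>k. \<exists>n. k \<le> H (run_prefix n \<omega>)"
  proof
    fix k
    obtain T where T: "T \<subseteq> {i. takes E s \<omega> i}" "finite T" "card T = k"
      using infinite_arbitrarily_large[OF inf] by blast
    \<comment> \<open>A prefix that reaches past \<open>Max T\<close> contains all \<open>k\<close>
      hits; for \<open>k = 0\<close> the set \<open>T\<close> is empty and any value of
      \<open>Max T\<close> will do.\<close>
    then have "T \<subseteq> {i. i < Suc (Max T) \<and> takes E s \<omega> i}"
      by (auto simp: less_Suc_eq_le)
    then have "card T \<le> card {i. i < Suc (Max T) \<and> takes E s \<omega> i}"
      by (intro card_mono) auto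
    then show "\<exists>n. k \<le> H (run_prefix n \<omega>)"
      using T by (auto simp: hits_run_prefix)
  qed
next
  assume *: "\<forall>k. \<exists>n. k \<le> H (run_prefix n \<omega>)"
  show "\<exists>\<^sub>\<infinity>i. takes E s \<omega> i"
    unfolding INFM_iff_infinite
  proof
    assume fin: "finite {i. takes E s \<omega> i}"
    obtain n where "Suc (card {i. takes E s \<omega> i}) \<le> H (run_prefix n \<omega>)" using * by blast
    moreover have "H (run_prefix n \<omega>) \<le> card {i. takes E s \<omega> i}"
      using fin by (auto simp: hits_run_prefix intro!: card_mono)
    ultimately show False by simp
  qed
qed

text \<open>Either the hits are unbounded and the powers tend to 0, or the sequence is constant
  after the last hit.\<close>

lemma discount_LIMSEQ:
  assumes "0 < \<zeta>" "\<zeta> < 1"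
  shows "(\<lambda>n. \<zeta> ^ H (run_prefix n \<omega>)) \<longlonglongrightarrow> discount E s \<zeta> \<omega>"
proof (cases "\<exists>\<^sub>\<infinity>i. takes E s \<omega> i")
  case True
  then have "filterlim (\<lambda>n. H (run_prefix n \<omega>)) at_top sequentially"
    unfolding infinitely_many_hits filterlim_at_top eventually_sequentially
    by (meson hits_mono order_trans)
  then have "(\<lambda>n. \<zeta> ^ H (run_prefix n \<omega>)) \<longlonglongrightarrow> 0"
    using assms by (intro filterlim_compose[OF LIMSEQ_realpow_zero]) auto
  with True show ?thesis by (simp add: discount_def)
next
  case False
  then have fin: "finite {i. takes E s \<omega> i}" by (simp add: INFM_iff_infinite)
  then obtain m where m: "\<And>i. takes E s \<omega> i \<Longrightarrow> i < m"
    by (auto dest!: finite_nat_bounded)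
  have "H (run_prefix n \<omega>) = card {i. takes E s \<omega> i}" if "m \<le> n" for n
  proof -
    have "{i. i < n \<and> takes E s \<omega> i} = {i. takes E s \<omega> i}"
      using that m less_le_trans by blast
    then show ?thesis by (simp add: hits_run_prefix)
  qed
  then have "\<forall>\<^sub>F n in sequentially. \<zeta> ^ H (run_prefix n \<omega>) = discount E s \<zeta> \<omega>"
    unfolding discount_def if_not_P[OF False] eventually_sequentially by (intro exI[of _ m]) simp
  then show ?thesis by (rule tendsto_eventually)
qed

lemma hits_measurable [measurable]: "(\<lambda>\<omega>. H (run_prefix n \<omega>)) \<in> measurable R (count_space UNIV)"
  by (rule measurable_compose[OF run_prefix_measurable_run]) simp

lemma infinitely_many_measurable [measurable]: "Measurable.pred R (\<lambda>\<omega>. \<exists>\<^sub>\<infinity>i. takes E s \<omega> i)"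
  unfolding infinitely_many_hits by measurable

lemma discount_bounds: "0 < \<zeta> \<Longrightarrow> \<zeta> < 1 \<Longrightarrow> 0 \<le> discount E s \<zeta> \<omega> \<and> discount E s \<zeta> \<omega> \<le> 1"
  by (auto simp: discount_def power_le_one)

lemma discount_measurable:
  assumes "0 < \<zeta>" "\<zeta> < 1"
  shows "discount E s \<zeta> \<in> borel_measurable R"
proof (rule borel_measurable_LIMSEQ_real)
  show "(\<lambda>n. \<zeta> ^ H (run_prefix n \<omega>)) \<longlonglongrightarrow> discount E s \<zeta> \<omega>" for \<omega>
    using assms by (rule discount_LIMSEQ)
  show "(\<lambda>\<omega>. \<zeta> ^ H (run_prefix n \<omega>)) \<in> borel_measurable R" for n
    by (rule measurable_compose[OF hits_measurable]) simp
qed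

lemma integrable_discount:
  assumes "0 < \<zeta>" "\<zeta> < 1"
  shows "integrable R (discount E s \<zeta>)"
proof -
  interpret prob_space R by (rule prob_space_run)
  show ?thesis
    using assms discount_measurable discount_bounds
    by (intro integrable_const_bound[where B = 1]) auto
qed

text \<open>Dominated convergence with the bound 1.\<close>

lemma escape_LIMSEQ:
  assumes "0 < \<zeta>" "\<zeta> < 1"
  shows "(\<lambda>n. stage_value n \<zeta> (\<lambda>_. 1)) \<longlonglongrightarrow> escape M E \<zeta> s f"
proof -
  interpret prob_space R by (rule prob_space_run)
  have "(\<lambda>n. \<integral>\<omega>. \<zeta> ^ H (run_prefix n \<omega>) \<partial>R) \<longlonglongrightarrow> (\<integral>\<omega>. discount E s \<zeta> \<omega> \<partial>R)"
  proof (rule integral_dominated_convergence[where w = "\<lambda>_. 1"])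
    show "discount E s \<zeta> \<in> borel_measurable R" using assms by (rule discount_measurable)
    show "(\<lambda>\<omega>. \<zeta> ^ H (run_prefix n \<omega>)) \<in> borel_measurable R" for n
      by (rule measurable_compose[OF hits_measurable]) simp
    show "AE \<omega> in R. (\<lambda>n. \<zeta> ^ H (run_prefix n \<omega>)) \<longlonglongrightarrow> discount E s \<zeta> \<omega>"
      using assms by (simp add: discount_LIMSEQ)
    show "AE \<omega> in R. norm (\<zeta> ^ H (run_prefix n \<omega>)) \<le> 1" for n
      using assms by (simp add: power_le_one)
  qed simp
  moreover have "(\<integral>\<omega>. \<zeta> ^ H (run_prefix n \<omega>) \<partial>R) = stage_value n \<zeta> (\<lambda>_. 1)" for n
    by (simp add: stage_value_def integral_prefix[of "\<lambda>xs. \<zeta> ^ H xs"] end_value_def)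
  ultimately show ?thesis by (simp add: escape_def)
qed

text \<open>Hit counts only grow with \<open>n\<close>, so the stage values decrease to their
  limit.\<close>

lemma escape_le_stage_value:
  assumes "0 < \<zeta>" "\<zeta> < 1"
  shows "escape M E \<zeta> s f \<le> stage_value n \<zeta> (\<lambda>_. 1)"
proof (rule decseq_ge[OF _ escape_LIMSEQ[OF assms]])
  interpret prob_space R by (rule prob_space_run)
  have i: "integrable R (\<lambda>\<omega>. \<zeta> ^ H (run_prefix n \<omega>))" for n
  proof (rule integrable_const_bound[where B = 1])
    show "AE \<omega> in R. norm (\<zeta> ^ H (run_prefix n \<omega>)) \<le> 1"
      using assms by (simp add: power_le_one)
    show "(\<lambda>\<omega>. \<zeta> ^ H (run_prefix n \<omega>)) \<in> borel_measurable R"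
      by (rule measurable_compose[OF hits_measurable]) simp
  qed
  have "stage_value n \<zeta> (\<lambda>_. 1) = (\<integral>\<omega>. \<zeta> ^ H (run_prefix n \<omega>) \<partial>R)" for n
    by (simp add: stage_value_def integral_prefix[of "\<lambda>xs. \<zeta> ^ H xs"] end_value_def)
  then show "decseq (\<lambda>n. stage_value n \<zeta> (\<lambda>_. 1))"
    using assms by (auto simp: decseq_def intro!: integral_mono i power_decreasing hits_mono)
qed

lemma escape_bounds:
  assumes "0 < \<zeta>" "\<zeta> < 1"
  shows "0 \<le> escape M E \<zeta> s f" "escape M E \<zeta> s f \<le> 1"
proof -
  interpret prob_space R by (rule prob_space_run)
  show "0 \<le> escape M E \<zeta> s f" "escape M E \<zeta> s f \<le> 1"
    using assms discount_bounds integrable_discount unfolding escape_def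
    by (auto intro!: integral_nonneg_AE integral_le_const)
qed

text \<open>\<open>discount\<close> is 0 on the Buechi event and at most 1 elsewhere, so the
  indicator of the event lies below \<open>1 - discount\<close>.\<close>

lemma prob_buchi_le_escape:
  assumes "0 < \<zeta>" "\<zeta> < 1"
  shows "prob_buchi M E s f \<le> 1 - escape M E \<zeta> s f"
proof -
  interpret prob_space R by (rule prob_space_run)
  let ?B = "{\<omega> \<in> space R. \<exists>\<^sub>\<infinity>i. takes E s \<omega> i}"
  have B: "?B \<in> sets R" by measurable
  have "prob_buchi M E s f = (\<integral>\<omega>. indicator ?B \<omega> \<partial>R)"
    using B by (simp add: prob_buchi_def)
  also have "\<dots> \<le> (\<integral>\<omega>. 1 - discount E s \<zeta> \<omega> \<partial>R)"
  proof (rule integral_mono)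
    show "integrable R (indicat_real ?B)"
      using B by (simp add: integrable_indicator_iff less_top[symmetric])
    show "integrable R (\<lambda>\<omega>. 1 - discount E s \<zeta> \<omega>)"
      using integrable_discount[OF assms] by simp
    show "indicator ?B \<omega> \<le> 1 - discount E s \<zeta> \<omega>" for \<omega>
      using discount_bounds[OF assms, of \<omega>] by (cases "\<omega> \<in> ?B") (simp_all add: discount_def)
  qed
  also have "\<dots> = 1 - escape M E \<zeta> s f"
    using integrable_discount[OF assms] by (simp add: escape_def prob_space)
  finally show ?thesis .
qed

text \<open>\<open>discount\<close> is nonnegative and, as \<open>0 < \<zeta>\<close>, vanishes
  exactly on the Buechi event.\<close>

lemma escape_eq_0_iff:
  assumes "0 < \<zeta>" "\<zeta> < 1"
  shows "escape M E \<zeta> s f = 0 \<longleftrightarrow> prob_buchi M E s f = 1"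
proof -
  interpret prob_space R by (rule prob_space_run)
  have "escape M E \<zeta> s f = 0 \<longleftrightarrow> (AE \<omega> in R. discount E s \<zeta> \<omega> = 0)"
    unfolding escape_def using assms discount_bounds
    by (intro integral_nonneg_eq_0_iff_AE integrable_discount) auto
  also have "\<dots> \<longleftrightarrow> (AE \<omega> in R. \<exists>\<^sub>\<infinity>i. takes E s \<omega> i)"
    using assms by (simp add: discount_def)
  also have "\<dots> \<longleftrightarrow> prob_buchi M E s f = 1"
    unfolding prob_buchi_def by (rule prob_Collect_eq_1[symmetric]) measurable
  finally show ?thesis .
qed

text \<open>Continuity from above: the Buechi event is the decreasing intersection over
  \<open>k\<close> of the events of at least \<open>k\<close> hits.\<close>

lemma prob_buchi_ge:
  assumes "\<And>k. c \<le> \<P>(\<omega> in R. \<exists>n. k \<le> H (run_prefix n \<omega>))"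
  shows "c \<le> prob_buchi M E s f"
proof -
  interpret prob_space R by (rule prob_space_run)
  let ?A = "\<lambda>k. {\<omega> \<in> space R. \<exists>n. k \<le> H (run_prefix n \<omega>)}"
  have "decseq ?A"
    by (auto simp: decseq_def) (meson order_trans)
  moreover have "range ?A \<subseteq> sets R" by auto
  ultimately have "(\<lambda>k. prob (?A k)) \<longlonglongrightarrow> prob (\<Inter>k. ?A k)"
    by (intro finite_Lim_measure_decseq)
  moreover have "(\<Inter>k. ?A k) = {\<omega> \<in> space R. \<exists>\<^sub>\<infinity>i. takes E s \<omega> i}"
    by (auto simp: infinitely_many_hits)
  ultimately have "(\<lambda>k. prob (?A k)) \<longlonglongrightarrow> prob_buchi M E s f"
    by (simp add: prob_buchi_def)
  then show ?thesis
    by (rule LIMSEQ_le_const) (use assms in auto)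
qed

end

text \<open>Makes \<open>action_value\<close> a finite sum over states, from which its monotonicity
  and continuity can be read off.\<close>

lemma integral_sum_states:
  fixes h :: "'s option \<Rightarrow> real"
  assumes "finite S" "set_pmf p \<subseteq> insert None (Some ` S)"
  shows "(\<integral>z. h z \<partial>measure_pmf p) = pmf p None * h None + (\<Sum>y\<in>S. pmf p (Some y) * h (Some y))"
proof -
  have "(\<integral>z. h z \<partial>measure_pmf p) = (\<Sum>z\<in>insert None (Some ` S). pmf p z * h z)"
    using assms by (subst integral_measure_pmf[of "insert None (Some ` S)"]) auto
  also have "\<dots> = pmf p None * h None + (\<Sum>z\<in>Some ` S. pmf p z * h z)"
    using assms by (subst sum.insert) auto
  also have "(\<Sum>z\<in>Some ` S. pmf p z * h z) = (\<Sum>y\<in>S. pmf p (Some y) * h (Some y))"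
    by (subst sum.reindex) auto
  finally show ?thesis .
qed

section \<open>Value iteration\<close>

text \<open>Value iteration from the cost 1 of a run without hits. States without actions are
  treated separately because \<open>Min\<close> of the empty set is unspecified.\<close>

primrec optimal_value_upto ::
  "('s, 'a, 'z) mdp_scheme \<Rightarrow> ('s \<times> 'a \<times> 's) set \<Rightarrow> real \<Rightarrow> nat \<Rightarrow> 's \<Rightarrow> real" where
  "optimal_value_upto M E \<zeta> 0 = (\<lambda>_. 1)"
| "optimal_value_upto M E \<zeta> (Suc n) =
     (\<lambda>x. if avail M x = {} then 1
          else Min (action_value M E \<zeta> (optimal_value_upto M E \<zeta> n) x ` avail M x))"

definition optimal_value ::
  "('s, 'a, 'z) mdp_scheme \<Rightarrow> ('s \<times> 'a \<times> 's) set \<Rightarrow> real \<Rightarrow> 's \<Rightarrow> real" where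
  "optimal_value M E \<zeta> x = (INF n. optimal_value_upto M E \<zeta> n x)"

text \<open>The interval is open on purpose: at \<open>\<zeta> = 1\<close> value iteration stays at
  1, whereas the limit from the left can be smaller.\<close>

definition limit_value ::
  "('s, 'a, 'z) mdp_scheme \<Rightarrow> ('s \<times> 'a \<times> 's) set \<Rightarrow> 's \<Rightarrow> real" where
  "limit_value M E x = (SUP \<zeta>\<in>{0<..<1}. optimal_value M E \<zeta> x)"

context finite_mdp
begin

lemma finite_states: "finite (states M)"
  using well_formed by (simp add: well_formed_def)

context
  fixes E :: "('s \<times> 'a \<times> 's) set"
begin

abbreviation "Q \<equiv> action_value M E"
abbreviation "U\<^sub>n \<equiv> optimal_value_upto M E"
abbreviation "U \<equiv> optimal_value M E"
abbreviation "Z \<equiv> limit_value M E"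

lemma action_value_sum:
  assumes "x \<in> states M" "a \<in> avail M x"
  shows "Q \<zeta> u x a = pmf (transition M x a) None +
    (\<Sum>y\<in>states M. spmf (transition M x a) y * ((if (x, a, y) \<in> E then \<zeta> else 1) * u y))"
  unfolding action_value_def
  by (subst integral_sum_states[OF finite_states set_transition[OF assms]]) simp

lemma action_value_mono:
  assumes "x \<in> states M" "a \<in> avail M x" "0 \<le> \<zeta>" "\<zeta> \<le> \<zeta>'"
    and "\<And>y. y \<in> states M \<Longrightarrow> 0 \<le> u y" "\<And>y. y \<in> states M \<Longrightarrow> u y \<le> u' y"
  shows "Q \<zeta> u x a \<le> Q \<zeta>' u' x a"
  unfolding action_value_sum[OF assms(1,2)] using assms(3-)
  by (intro add_left_mono sum_mono mult_left_mono) (auto intro!: mult_mono)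

lemma action_value_nonneg:
  assumes "x \<in> states M" "a \<in> avail M x" "0 \<le> \<zeta>" "\<And>y. y \<in> states M \<Longrightarrow> 0 \<le> u y"
  shows "0 \<le> Q \<zeta> u x a"
  unfolding action_value_sum[OF assms(1,2)] using assms(3-)
  by (intro add_nonneg_nonneg sum_nonneg mult_nonneg_nonneg) auto

text \<open>The mass of \<open>None\<close> is counted with cost 1, so the total is 1 even for a
  proper sub-distribution.\<close>

lemma action_value_one: "Q 1 (\<lambda>_. 1) x a = 1"
proof -
  have "(case z of None \<Rightarrow> 1 | Some x' \<Rightarrow> (if (x, a, x') \<in> E then 1 else 1) * 1) = (1::real)" for z
    by (cases z) auto
  then show ?thesis by (simp add: action_value_def)
qed

lemma action_value_tendsto:
  assumes "x \<in> states M" "a \<in> avail M x" "(\<zeta> \<longlongrightarrow> \<zeta>') F"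
    and "\<And>y. y \<in> states M \<Longrightarrow> ((\<lambda>i. u i y) \<longlongrightarrow> u' y) F"
  shows "((\<lambda>i. Q (\<zeta> i) (u i) x a) \<longlongrightarrow> Q \<zeta>' u' x a) F"
  unfolding action_value_sum[OF assms(1,2)] using assms(3-)
  by (intro tendsto_intros) auto

lemma Min_action_value:
  assumes "x \<in> states M"
  shows "a \<in> avail M x \<Longrightarrow> Min (Q \<zeta> u x ` avail M x) \<le> Q \<zeta> u x a"
    and "avail M x \<noteq> {} \<Longrightarrow> \<exists>a\<in>avail M x. Q \<zeta> u x a = Min (Q \<zeta> u x ` avail M x)"
proof -
  have fin: "finite (Q \<zeta> u x ` avail M x)" using finite_avail[OF assms(1)] by simp
  then show "a \<in> avail M x \<Longrightarrow> Min (Q \<zeta> u x ` avail M x) \<le> Q \<zeta> u x a"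
    by simp
  assume "avail M x \<noteq> {}"
  then show "\<exists>a\<in>avail M x. Q \<zeta> u x a = Min (Q \<zeta> u x ` avail M x)"
    using fin Min_in[of "Q \<zeta> u x ` avail M x"] by fastforce
qed

lemma optimal_value_upto_Suc_le:
  "x \<in> states M \<Longrightarrow> a \<in> avail M x \<Longrightarrow> U\<^sub>n \<zeta> (Suc n) x \<le> Q \<zeta> (U\<^sub>n \<zeta> n) x a"
  using Min_action_value(1)[of x a] by auto

lemma optimal_value_upto_Suc_attained:
  "x \<in> states M \<Longrightarrow> avail M x \<noteq> {} \<Longrightarrow> \<exists>a\<in>avail M x. Q \<zeta> (U\<^sub>n \<zeta> n) x a = U\<^sub>n \<zeta> (Suc n) x"
  using Min_action_value(2)[of x] by auto

lemma optimal_value_upto_nonneg: "0 \<le> \<zeta> \<Longrightarrow> x \<in> states M \<Longrightarrow> 0 \<le> U\<^sub>n \<zeta> n x"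
proof (induction n arbitrary: x)
  case (Suc n)
  show ?case
  proof (cases "avail M x = {}")
    case False
    then obtain a where a: "a \<in> avail M x" "Q \<zeta> (U\<^sub>n \<zeta> n) x a = U\<^sub>n \<zeta> (Suc n) x"
      using optimal_value_upto_Suc_attained Suc.prems by blast
    show ?thesis
      unfolding a(2)[symmetric] using Suc a(1) by (intro action_value_nonneg)
  qed simp
qed simp

text \<open>The value for the smaller discount is bounded by trying an action that is optimal for
  the larger one.\<close>

lemma optimal_value_upto_mono_zeta:
  "0 \<le> \<zeta> \<Longrightarrow> \<zeta> \<le> \<zeta>' \<Longrightarrow> x \<in> states M \<Longrightarrow> U\<^sub>n \<zeta> n x \<le> U\<^sub>n \<zeta>' n x"
proof (induction n arbitrary: x)
  case (Suc n)
  show ?case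
  proof (cases "avail M x = {}")
    case False
    then obtain a where a: "a \<in> avail M x" "Q \<zeta>' (U\<^sub>n \<zeta>' n) x a = U\<^sub>n \<zeta>' (Suc n) x"
      using optimal_value_upto_Suc_attained Suc.prems by blast
    have "U\<^sub>n \<zeta> (Suc n) x \<le> Q \<zeta> (U\<^sub>n \<zeta> n) x a"
      using a Suc.prems by (intro optimal_value_upto_Suc_le)
    also have "\<dots> \<le> Q \<zeta>' (U\<^sub>n \<zeta>' n) x a"
      using a Suc by (intro action_value_mono optimal_value_upto_nonneg)
    finally show ?thesis using a by simp
  qed simp
qed simp

lemma optimal_value_upto_le_one: "0 \<le> \<zeta> \<Longrightarrow> \<zeta> \<le> 1 \<Longrightarrow> x \<in> states M \<Longrightarrow> U\<^sub>n \<zeta> n x \<le> 1"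
proof (induction n arbitrary: x)
  case (Suc n)
  show ?case
  proof (cases "avail M x = {}")
    case False
    then obtain a where a: "a \<in> avail M x" by blast
    have "U\<^sub>n \<zeta> (Suc n) x \<le> Q \<zeta> (U\<^sub>n \<zeta> n) x a"
      using a Suc.prems by (intro optimal_value_upto_Suc_le)
    also have "\<dots> \<le> Q 1 (\<lambda>_. 1) x a"
      using a Suc by (intro action_value_mono optimal_value_upto_nonneg) auto
    finally show ?thesis by (simp add: action_value_one)
  qed simp
qed simp

text \<open>The base case is the bound 1. The induction step tries an action that is optimal for the
  shorter horizon and uses monotonicity of \<open>action_value\<close>.\<close>

lemma optimal_value_upto_Suc_mono:
  "0 \<le> \<zeta> \<Longrightarrow> \<zeta> \<le> 1 \<Longrightarrow> x \<in> states M \<Longrightarrow> U\<^sub>n \<zeta> (Suc n) x \<le> U\<^sub>n \<zeta> n x"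
proof (induction n arbitrary: x)
  case 0
  then show ?case using optimal_value_upto_le_one[of \<zeta> x "Suc 0"] by simp
next
  case (Suc n)
  show ?case
  proof (cases "avail M x = {}")
    case False
    then obtain a where a: "a \<in> avail M x" "Q \<zeta> (U\<^sub>n \<zeta> n) x a = U\<^sub>n \<zeta> (Suc n) x"
      using optimal_value_upto_Suc_attained Suc.prems by blast
    have "U\<^sub>n \<zeta> (Suc (Suc n)) x \<le> Q \<zeta> (U\<^sub>n \<zeta> (Suc n)) x a"
      using a Suc.prems by (intro optimal_value_upto_Suc_le)
    also have "\<dots> \<le> Q \<zeta> (U\<^sub>n \<zeta> n) x a"
      using a(1) Suc by (intro action_value_mono optimal_value_upto_nonneg order_refl)
    finally show ?thesis using a by simp
  qed simp
qed

section \<open>Infinite horizon\<close>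

lemma optimal_value_LIMSEQ:
  assumes "0 \<le> \<zeta>" "\<zeta> \<le> 1" "x \<in> states M"
  shows "(\<lambda>n. U\<^sub>n \<zeta> n x) \<longlonglongrightarrow> U \<zeta> x"
  unfolding optimal_value_def
proof (rule LIMSEQ_decseq_INF)
  show "bdd_below (range (\<lambda>n. U\<^sub>n \<zeta> n x))"
    using optimal_value_upto_nonneg assms by (intro bdd_belowI[of _ 0]) auto
  show "decseq (\<lambda>n. U\<^sub>n \<zeta> n x)"
    using assms by (intro decseq_SucI optimal_value_upto_Suc_mono)
qed

lemma optimal_value_bounds:
  assumes "0 \<le> \<zeta>" "\<zeta> \<le> 1" "x \<in> states M"
  shows "0 \<le> U \<zeta> x" "U \<zeta> x \<le> 1"
  using optimal_value_upto_nonneg optimal_value_upto_le_one assms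
  by (auto intro!: LIMSEQ_le_const[OF optimal_value_LIMSEQ] LIMSEQ_le_const2[OF optimal_value_LIMSEQ])

lemma optimal_value_mono:
  assumes "0 \<le> \<zeta>" "\<zeta> \<le> \<zeta>'" "\<zeta>' \<le> 1" "x \<in> states M"
  shows "U \<zeta> x \<le> U \<zeta>' x"
  using assms optimal_value_upto_mono_zeta
  by (intro LIMSEQ_le[OF optimal_value_LIMSEQ optimal_value_LIMSEQ]) auto

text \<open>The limit of the same inequality for the iterates. It makes \<open>U \<zeta>\<close> a
  function below its Bellman backup, as \<open>stage_value_mono\<close> requires.\<close>

lemma optimal_value_le_action_value:
  assumes "0 \<le> \<zeta>" "\<zeta> \<le> 1" "x \<in> states M" "a \<in> avail M x"
  shows "U \<zeta> x \<le> Q \<zeta> (U \<zeta>) x a"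
proof (rule LIMSEQ_le)
  show "(\<lambda>n. U\<^sub>n \<zeta> (Suc n) x) \<longlonglongrightarrow> U \<zeta> x"
    using assms by (intro LIMSEQ_Suc optimal_value_LIMSEQ)
  show "(\<lambda>n. Q \<zeta> (U\<^sub>n \<zeta> n) x a) \<longlonglongrightarrow> Q \<zeta> (U \<zeta>) x a"
    using assms by (intro action_value_tendsto optimal_value_LIMSEQ) auto
  show "\<exists>N. \<forall>n\<ge>N. U\<^sub>n \<zeta> (Suc n) x \<le> Q \<zeta> (U\<^sub>n \<zeta> n) x a"
    using assms optimal_value_upto_Suc_le by blast
qed

lemma optimal_value_final: "avail M x = {} \<Longrightarrow> U \<zeta> x = 1"
proof -
  assume "avail M x = {}"
  then have "U\<^sub>n \<zeta> n x = 1" for n by (cases n) auto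
  then show ?thesis by (simp add: optimal_value_def)
qed

section \<open>The limit of the optimal values for \<zeta> tending to 1\<close>

lemma bdd_above_optimal_value: "x \<in> states M \<Longrightarrow> bdd_above ((\<lambda>\<zeta>. U \<zeta> x) ` {0<..<1})"
  using optimal_value_bounds by (intro bdd_aboveI[of _ 1]) auto

lemma optimal_value_le_limit:
  "x \<in> states M \<Longrightarrow> 0 < \<zeta> \<Longrightarrow> \<zeta> < 1 \<Longrightarrow> U \<zeta> x \<le> Z x"
  unfolding limit_value_def by (intro cSUP_upper bdd_above_optimal_value) auto

lemma limit_value_least:
  "(\<And>\<zeta>. 0 < \<zeta> \<Longrightarrow> \<zeta> < 1 \<Longrightarrow> U \<zeta> x \<le> c) \<Longrightarrow> Z x \<le> c"
  unfolding limit_value_def by (intro cSUP_least) auto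

lemma limit_value_bounds:
  assumes "x \<in> states M"
  shows "0 \<le> Z x" "Z x \<le> 1"
proof -
  have "0 \<le> U (1 / 2) x" using assms by (intro optimal_value_bounds) auto
  also have "\<dots> \<le> Z x" using assms by (intro optimal_value_le_limit) auto
  finally show "0 \<le> Z x" .
  show "Z x \<le> 1" using assms optimal_value_bounds by (intro limit_value_least) auto
qed

lemma limit_value_final: "avail M x = {} \<Longrightarrow> Z x = 1"
  by (simp add: limit_value_def optimal_value_final)

text \<open>Since \<open>U\<close> increases with \<zeta>, its supremum is its limit from the
  left.\<close>

lemma optimal_value_tendsto:
  assumes "x \<in> states M"
  shows "((\<lambda>\<zeta>. U \<zeta> x) \<longlongrightarrow> Z x) (at_left 1)"
proof (rule order_tendstoI)
  fix c assume "c < Z x"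
  then obtain \<zeta> where \<zeta>: "0 < \<zeta>" "\<zeta> < 1" "c < U \<zeta> x"
    unfolding limit_value_def using less_cSUP_iff[OF _ bdd_above_optimal_value[OF assms], of c] by auto
  have "c < U \<zeta>' x" if "\<zeta> < \<zeta>'" "\<zeta>' < 1" for \<zeta>'
    using optimal_value_mono[of \<zeta> \<zeta>' x] \<zeta> that assms by auto
  then show "\<forall>\<^sub>F \<zeta> in at_left 1. c < U \<zeta> x"
    using \<zeta> unfolding eventually_at_left[OF \<zeta>(2)] by blast
next
  fix c assume "Z x < c"
  then have "U \<zeta>' x < c" if "0 < \<zeta>'" "\<zeta>' < 1" for \<zeta>'
    using optimal_value_le_limit[OF assms that] by simp
  then show "\<forall>\<^sub>F \<zeta> in at_left 1. U \<zeta> x < c"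
    unfolding eventually_at_left[OF zero_less_one] by (intro exI[of _ 0]) auto
qed

text \<open>The right side is first enlarged to \<open>\<zeta> = 1\<close> and \<open>Z\<close>,
  where it no longer depends on \<zeta>; then the supremum is taken on the left.\<close>

lemma limit_value_le_action_value:
  assumes "x \<in> states M" "a \<in> avail M x"
  shows "Z x \<le> Q 1 Z x a"
proof (rule limit_value_least)
  fix \<zeta> :: real assume \<zeta>: "0 < \<zeta>" "\<zeta> < 1"
  have "U \<zeta> x \<le> Q \<zeta> (U \<zeta>) x a"
    using \<zeta> assms by (intro optimal_value_le_action_value) auto
  also have "\<dots> \<le> Q 1 Z x a"
    using \<zeta> assms by (intro action_value_mono optimal_value_bounds optimal_value_le_limit) auto
  finally show "U \<zeta> x \<le> Q 1 Z x a" .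
qed

text \<open>An action that does not preserve \<open>Z\<close> has a positive gap
  \<open>Q 1 Z x a - Z x\<close>. By continuity the gap for \<open>U \<zeta>\<close> stays positive
  near 1, so the action is not tight there; finitely many state-action pairs share one
  threshold.\<close>

lemma tight_actions_preserve_limit_value:
  obtains \<zeta>0 where "0 < \<zeta>0" "\<zeta>0 < 1"
    and "\<And>\<zeta> x a. \<zeta>0 \<le> \<zeta> \<Longrightarrow> \<zeta> < 1 \<Longrightarrow> x \<in> states M \<Longrightarrow> a \<in> avail M x \<Longrightarrow>
      Q \<zeta> (U \<zeta>) x a = U \<zeta> x \<Longrightarrow> Q 1 Z x a = Z x"
proof -
  let ?P = "\<lambda>\<zeta> x a. Q \<zeta> (U \<zeta>) x a = U \<zeta> x \<longrightarrow> Q 1 Z x a = Z x"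
  have ev: "\<forall>\<^sub>F \<zeta> in at_left 1. ?P \<zeta> x a" if xa: "x \<in> states M" "a \<in> avail M x" for x a
  proof (cases "Q 1 Z x a = Z x")
    case False
    then have "0 < Q 1 Z x a - Z x"
      using limit_value_le_action_value[OF xa] by simp
    moreover have "((\<lambda>\<zeta>. Q \<zeta> (U \<zeta>) x a - U \<zeta> x) \<longlongrightarrow> Q 1 Z x a - Z x) (at_left 1)"
      using xa by (intro tendsto_diff action_value_tendsto optimal_value_tendsto tendsto_ident_at) auto
    ultimately have "\<forall>\<^sub>F \<zeta> in at_left 1. 0 < Q \<zeta> (U \<zeta>) x a - U \<zeta> x"
      by (rule order_tendstoD(1)[rotated])
    then show ?thesis by (rule eventually_mono) auto
  qed simp
  have "\<forall>\<^sub>F \<zeta> in at_left 1. \<forall>x\<in>states M. \<forall>a\<in>avail M x. ?P \<zeta> x a"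
    by (intro eventually_ball_finite ballI finite_states finite_avail ev)
  then obtain b where b: "b < 1" "\<And>\<zeta>. b < \<zeta> \<Longrightarrow> \<zeta> < 1 \<Longrightarrow> \<forall>x\<in>states M. \<forall>a\<in>avail M x. ?P \<zeta> x a"
    unfolding eventually_at_left[OF zero_less_one] by blast
  show thesis
  \<comment> \<open>The midpoint of \<open>max b 0\<close> and 1 lies in the open unit interval and
    strictly above \<open>b\<close>, so the closed lower bound on \<zeta> implies
    \<open>b < \<zeta>\<close>.\<close>
  proof (rule that[of "(max b 0 + 1) / 2"])
    fix \<zeta> x a assume "(max b 0 + 1) / 2 \<le> \<zeta>" "\<zeta> < 1" "x \<in> states M" "a \<in> avail M x" "Q \<zeta> (U \<zeta>) x a = U \<zeta> x"
    moreover from this(1) b(1) have "b < \<zeta>" by (auto simp: max_def split: if_splits)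
    ultimately show "Q 1 Z x a = Z x" using b(2) by blast
  qed (use b in auto)
qed

section \<open>Optimal values and strategies\<close>

text \<open>The stage values of \<open>U \<zeta>\<close> start at \<open>U \<zeta> s\<close>, never
  decrease, and stay below those of the constant 1, which tend to \<open>escape\<close>.\<close>

lemma optimal_value_le_escape:
  assumes "0 < \<zeta>" "\<zeta> < 1" "s \<in> states M" "f \<in> strategies M"
  shows "U \<zeta> s \<le> escape M E \<zeta> s f"
proof -
  interpret B: buchi_run M f s E
    using assms by unfold_locales
  have U: "0 \<le> U \<zeta> x" "U \<zeta> x \<le> 1" if "x \<in> states M" for x
    using optimal_value_bounds[of \<zeta> x] assms that by auto
  have mono: "B.stage_value n \<zeta> (U \<zeta>) \<le> B.stage_value (Suc n) \<zeta> (U \<zeta>)" for n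
    using U optimal_value_le_action_value assms by (intro B.stage_value_mono) auto
  have "U \<zeta> s \<le> B.stage_value n \<zeta> (U \<zeta>)" for n
    by (induction n) (auto intro: order_trans[OF _ mono])
  moreover have "B.stage_value n \<zeta> (U \<zeta>) \<le> B.stage_value n \<zeta> (\<lambda>_. 1)" for n
    using U assms by (intro B.stage_value_mono_fun) auto
  ultimately have "U \<zeta> s \<le> B.stage_value n \<zeta> (\<lambda>_. 1)" for n
    by (blast intro: order_trans)
  then show ?thesis
    using assms by (intro LIMSEQ_le_const[OF B.escape_LIMSEQ]) auto
qed

text \<open>The strategy depends on time: with \<open>k\<close> steps to go it minimises \<open>action_value\<close> of stage \<open>k - 1\<close>.\<close>

lemma greedy_strategy:
  assumes "0 < \<zeta>" "\<zeta> < 1" "s \<in> states M"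
  shows "\<exists>g\<in>strategies M. escape M E \<zeta> s g \<le> U\<^sub>n \<zeta> n s"
proof -
  \<comment> \<open>After \<open>k = length (snd r)\<close> steps, \<open>n - Suc k\<close> remain
    after this choice. \<open>Suc (n - Suc k)\<close> is \<open>n - k\<close> as long as
    \<open>k < n\<close>; beyond the horizon the truncated subtraction gives 0, and the choice is
    still an available action.\<close>
  define best where "best r = (SOME a. a \<in> avail M (last_state r) \<and>
      Q \<zeta> (U\<^sub>n \<zeta> (n - Suc (length (snd r)))) (last_state r) a =
      U\<^sub>n \<zeta> (Suc (n - Suc (length (snd r)))) (last_state r))" for r :: "('s, 'a) frun"
  have best: "best r \<in> avail M (last_state r)"
      "Q \<zeta> (U\<^sub>n \<zeta> (n - Suc (length (snd r)))) (last_state r) (best r) =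
      U\<^sub>n \<zeta> (Suc (n - Suc (length (snd r)))) (last_state r)" if r: "r \<in> decision_runs M" for r
  proof -
    have "avail M (last_state r) \<noteq> {}" using r by (simp add: decision_runs_def)
    from optimal_value_upto_Suc_attained[OF last_state_in[OF r] this]
    have "\<exists>a. a \<in> avail M (last_state r) \<and>
      Q \<zeta> (U\<^sub>n \<zeta> (n - Suc (length (snd r)))) (last_state r) a =
      U\<^sub>n \<zeta> (Suc (n - Suc (length (snd r)))) (last_state r)" by blast
    from someI_ex[OF this] show "best r \<in> avail M (last_state r)"
      "Q \<zeta> (U\<^sub>n \<zeta> (n - Suc (length (snd r)))) (last_state r) (best r) =
      U\<^sub>n \<zeta> (Suc (n - Suc (length (snd r)))) (last_state r)"
      unfolding best_def by blast+
  qed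
  define g where "g = restrict (\<lambda>r. return_pmf (best r)) (decision_runs M)"
  have g: "g \<in> strategies M"
    using best(1) by (auto simp: g_def strategies_def)
  interpret B: buchi_run M g s E
    using assms g by unfold_locales
  \<comment> \<open>An invariant along the greedy strategy: the cost so far combined with the
    optimal cost of the remaining \<open>n - k\<close> steps. At \<open>k = n\<close> the remaining
    cost is the constant 1.\<close>
  have "B.stage_value k \<zeta> (U\<^sub>n \<zeta> (n - k)) = U\<^sub>n \<zeta> n s" if "k \<le> n" for k
    using that
  proof (induction k)
    case (Suc k)
    have "B.stage_value (Suc k) \<zeta> (U\<^sub>n \<zeta> (n - Suc k)) = B.stage_value k \<zeta> (U\<^sub>n \<zeta> (n - k))"
    proof (rule B.stage_value_Suc_eq)
      fix xs assume xs: "xs \<in> set_pmf (prefix_pmf M g s k)"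
      have nk: "n - k = Suc (n - Suc k)" using Suc.prems by simp
      show "B.step_value \<zeta> (U\<^sub>n \<zeta> (n - Suc k)) xs = end_value (U\<^sub>n \<zeta> (n - k)) s xs"
        using xs
      proof (cases rule: B.end_value_cases[of xs k "U\<^sub>n \<zeta> (n - Suc k)" \<zeta>])
        case moving
        have "g (s, map the xs) = return_pmf (best (s, map the xs))"
          using moving by (simp add: g_def del: last_state.simps)
        then have "B.step_value \<zeta> (U\<^sub>n \<zeta> (n - Suc k)) xs = U\<^sub>n \<zeta> (n - k) (last_state (s, map the xs))"
          using moving best(2)[OF moving(2)] length_prefix_pmf[OF xs]
          by (simp add: nk del: last_state.simps optimal_value_upto.simps)
        then show ?thesis using moving by (simp add: end_value_def)
      qed (auto simp: end_value_def nk)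
    qed
    with Suc show ?case by simp
  qed simp
  from this[of n] have "B.stage_value n \<zeta> (\<lambda>_. 1) = U\<^sub>n \<zeta> n s" by simp
  then show ?thesis
    using B.escape_le_stage_value[OF assms(1,2), of n] g by auto
qed

text \<open>A minimal strategy does at least as well as the greedy strategy of every horizon, so its
  \<open>escape\<close> lies below all iterates and hence below their limit.\<close>

lemma minimal_escape_eq_optimal_value:
  assumes "0 < \<zeta>" "\<zeta> < 1" "s \<in> states M" "f \<in> strategies M"
    and min: "\<And>g. g \<in> strategies M \<Longrightarrow> escape M E \<zeta> s f \<le> escape M E \<zeta> s g"
  shows "escape M E \<zeta> s f = U \<zeta> s"
proof (rule antisym)
  show "escape M E \<zeta> s f \<le> U \<zeta> s"
  proof (rule LIMSEQ_le_const[OF optimal_value_LIMSEQ])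
    show "\<exists>N. \<forall>n\<ge>N. escape M E \<zeta> s f \<le> U\<^sub>n \<zeta> n s"
      using greedy_strategy[OF assms(1-3)] min by (meson order_trans)
  qed (use assms in auto)
qed (rule optimal_value_le_escape[OF assms(1-4)])

text \<open>For each \<zeta> the probability is at most \<open>1 - escape\<close>, hence at most
  \<open>1 - U \<zeta> s\<close>; the best of these bounds is \<open>1 - Z s\<close>.\<close>

lemma prob_buchi_le_limit_value:
  assumes "s \<in> states M" "f \<in> strategies M"
  shows "prob_buchi M E s f \<le> 1 - Z s"
proof -
  interpret B: buchi_run M f s E
    using assms by unfold_locales
  have "Z s \<le> 1 - prob_buchi M E s f"
  proof (rule limit_value_least)
    fix \<zeta> :: real assume "0 < \<zeta>" "\<zeta> < 1"
    then show "U \<zeta> s \<le> 1 - prob_buchi M E s f"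
      using B.prob_buchi_le_escape[of \<zeta>] optimal_value_le_escape[of \<zeta> s f] assms by simp
  qed
  then show ?thesis by simp
qed

text \<open>The strategy plays only tight actions, so it never loses any of the value
  \<open>1 - Z s\<close>; the part of this value left on runs with few hits vanishes in the
  limit.\<close>

lemma minimal_escape_prob_buchi:
  assumes \<zeta>: "0 < \<zeta>" "\<zeta> < 1" and s: "s \<in> states M" and f: "f \<in> strategies M"
    and escape: "escape M E \<zeta> s f = U \<zeta> s"
    and preserve: "\<And>x a. x \<in> states M \<Longrightarrow> a \<in> avail M x \<Longrightarrow> Q \<zeta> (U \<zeta>) x a = U \<zeta> x \<Longrightarrow> Q 1 Z x a = Z x"
  shows "1 - Z s \<le> prob_buchi M E s f"
proof -
  interpret B: buchi_run M f s E
    using s f by unfold_locales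
  interpret R: prob_space "run_measure M f s" by (rule B.prob_space_run)
  have U: "0 \<le> U \<zeta> x" "U \<zeta> x \<le> 1" if "x \<in> states M" for x
    using optimal_value_bounds[of \<zeta> x] \<zeta> that by auto
  have UQ: "U \<zeta> x \<le> Q \<zeta> (U \<zeta>) x a" if "x \<in> states M" "a \<in> avail M x" for x a
    using that \<zeta> by (intro optimal_value_le_action_value) auto
  have mono: "incseq (\<lambda>n. B.stage_value n \<zeta> (U \<zeta>))"
    using U UQ \<zeta> by (intro incseq_SucI B.stage_value_mono) auto
  have le: "B.stage_value n \<zeta> (U \<zeta>) \<le> B.stage_value n \<zeta> (\<lambda>_. 1)" for n
    using U \<zeta> by (intro B.stage_value_mono_fun) auto
  \<comment> \<open>The sequence starts at \<open>U \<zeta> s\<close>, is nondecreasing, and is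
    bounded by \<open>escape\<close>, which equals its first member.\<close>
  have const: "B.stage_value n \<zeta> (U \<zeta>) = U \<zeta> s" for n
  proof (rule antisym)
    show "B.stage_value n \<zeta> (U \<zeta>) \<le> U \<zeta> s"
      unfolding escape[symmetric]
    proof (rule LIMSEQ_le_const[OF B.escape_LIMSEQ[OF \<zeta>]], intro exI allI impI)
      fix m assume "n \<le> m"
      then show "B.stage_value n \<zeta> (U \<zeta>) \<le> B.stage_value m \<zeta> (\<lambda>_. 1)"
        using incseqD[OF mono] le[of m] order_trans by blast
    qed
    show "U \<zeta> s \<le> B.stage_value n \<zeta> (U \<zeta>)"
      using incseqD[OF mono, of 0 n] by simp
  qed
  \<comment> \<open>Constant stage values make every played action tight for
    \<open>U \<zeta>\<close>, and \<open>preserve\<close> turns this into invariance of the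
    undiscounted expectation of \<open>Z\<close>.\<close>
  have Z: "B.stage_value n 1 Z = Z s" for n
  proof (induction n)
    case (Suc n)
    have "B.stage_value (Suc n) 1 Z = B.stage_value n 1 Z"
    proof (rule B.stage_value_Suc_eq)
      fix xs assume xs: "xs \<in> set_pmf (prefix_pmf M f s n)"
      then show "B.step_value 1 Z xs = end_value Z s xs"
      proof (cases rule: B.end_value_cases[of xs n Z 1])
        case moving
        let ?r = "(s, map the xs)"
        have "Q 1 Z (last_state ?r) a = Z (last_state ?r)" if a: "a \<in> set_pmf (f ?r)" for a
        proof (rule preserve)
          show "a \<in> avail M (last_state ?r)" using B.set_strategy[OF moving(2)] a by blast
          show "Q \<zeta> (U \<zeta>) (last_state ?r) a = U \<zeta> (last_state ?r)"
            using U UQ \<zeta> a xs moving const by (intro B.stage_value_tight[of _ _ n]) auto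
        qed (rule moving(3))
        then have "(\<integral>a. Q 1 Z (last_state ?r) a \<partial>f ?r) = (\<integral>a. Z (last_state ?r) \<partial>f ?r)"
          by (intro integral_cong_AE) (auto simp: AE_measure_pmf_iff simp del: last_state.simps)
        then show ?thesis using moving by (simp del: last_state.simps)
      qed (auto simp: limit_value_final)
    qed
    with Suc show ?case by simp
  qed simp
  \<comment> \<open>This is the expectation of \<open>\<zeta> ^ H * (1 - U \<zeta>)\<close> after
    \<open>n\<close> steps, with 0 for stopped runs. It vanishes in the limit because
    \<open>escape\<close> equals \<open>U \<zeta> s\<close>.\<close>
  define \<epsilon> where "\<epsilon> n = B.stage_value n \<zeta> (\<lambda>_. 1) - B.stage_value n \<zeta> (U \<zeta>)" for n
  have \<epsilon>0: "\<epsilon> \<longlonglongrightarrow> 0"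
    using tendsto_diff[OF B.escape_LIMSEQ[OF \<zeta>] tendsto_const[of "U \<zeta> s"]]
    unfolding \<epsilon>_def const by (simp add: escape)
  show ?thesis
  proof (rule B.prob_buchi_ge)
    fix k
    let ?H = "hits E s"
    let ?p = "\<P>(\<omega> in run_measure M f s. \<exists>n. k \<le> ?H (run_prefix n \<omega>))"
    \<comment> \<open>Split the prefixes at \<open>k\<close> hits. Those with at least
      \<open>k\<close> contribute at most their probability; on the others
      \<open>\<zeta> ^ H / \<zeta> ^ k\<close> is at least 1 and \<open>1 - Z\<close> is at most
      \<open>1 - U \<zeta>\<close>, as in a Markov inequality.\<close>
    have "1 - Z s \<le> ?p + \<epsilon> n / \<zeta> ^ k" for n
    proof -
      let ?D = "measure_pmf (prefix_pmf M f s n)"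
      have "1 - Z s = (\<integral>xs. 1 - end_value Z s xs \<partial>?D)"
        using Z[of n] by (simp add: B.stage_value_def B.integrable_prefix)
      also have "\<dots> \<le> (\<integral>xs. indicator {xs. k \<le> ?H xs} xs + (\<zeta> ^ ?H xs * (1 - end_value (U \<zeta>) s xs)) / \<zeta> ^ k \<partial>?D)"
      proof (intro integral_mono_AE B.integrable_prefix, unfold AE_measure_pmf_iff, rule ballI)
        fix xs assume xs: "xs \<in> set_pmf (prefix_pmf M f s n)"
        have V: "0 \<le> end_value Z s xs" "end_value (U \<zeta>) s xs \<le> end_value Z s xs" "end_value (U \<zeta>) s xs \<le> 1"
          using xs limit_value_bounds optimal_value_le_limit U \<zeta>
          by (cases rule: B.end_value_cases[of xs n "U \<zeta>" \<zeta>]; simp add: end_value_def del: last_state.simps)+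
        show "1 - end_value Z s xs \<le> indicator {xs. k \<le> ?H xs} xs + (\<zeta> ^ ?H xs * (1 - end_value (U \<zeta>) s xs)) / \<zeta> ^ k"
        proof (cases "k \<le> ?H xs")
          case True
          then show ?thesis using V \<zeta> by (simp add: add_increasing2)
        next
          case False
          then have "\<zeta> ^ k \<le> \<zeta> ^ ?H xs" using \<zeta> by (intro power_decreasing) auto
          then have "\<zeta> ^ k * (1 - end_value (U \<zeta>) s xs) \<le> \<zeta> ^ ?H xs * (1 - end_value (U \<zeta>) s xs)"
            using V by (intro mult_right_mono) auto
          then have "1 - end_value (U \<zeta>) s xs \<le> (\<zeta> ^ ?H xs * (1 - end_value (U \<zeta>) s xs)) / \<zeta> ^ k"
            using \<zeta> by (simp add: pos_le_divide_eq mult.commute)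
          with False V show ?thesis by simp
        qed
      qed
      also have "\<dots> = measure ?D {xs. k \<le> ?H xs} + \<epsilon> n / \<zeta> ^ k"
        by (simp add: \<epsilon>_def B.stage_value_def B.integrable_prefix end_value_def[of "\<lambda>_. 1"] right_diff_distrib)
      also have "measure ?D {xs. k \<le> ?H xs} = \<P>(\<omega> in run_measure M f s. k \<le> ?H (run_prefix n \<omega>))"
        by (rule B.prob_prefix[symmetric])
      also have "\<dots> \<le> ?p"
        by (intro R.finite_measure_mono) auto
      finally show ?thesis by simp
    qed
    moreover have "(\<lambda>n. ?p + \<epsilon> n / \<zeta> ^ k) \<longlonglongrightarrow> ?p + 0 / \<zeta> ^ k"
      using \<epsilon>0 \<zeta> by (intro tendsto_intros) auto
    ultimately show "1 - Z s \<le> ?p"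
      using LIMSEQ_le_const[of "\<lambda>n. ?p + \<epsilon> n / \<zeta> ^ k" ?p "1 - Z s"] by simp
  qed
qed

text \<open>The bound \<open>1 - Z s\<close> holds for every strategy and is attained by each
  minimiser of \<open>escape\<close>, once \<zeta> passes the threshold for tight actions.\<close>

theorem minimal_escape_imp_buchi_optimal:
  assumes s: "s \<in> states M"
  obtains \<zeta>0 where "0 < \<zeta>0" "\<zeta>0 < 1"
    and "\<And>\<zeta> f g. \<zeta>0 \<le> \<zeta> \<Longrightarrow> \<zeta> < 1 \<Longrightarrow> f \<in> strategies M \<Longrightarrow>
      (\<And>h. h \<in> strategies M \<Longrightarrow> escape M E \<zeta> s f \<le> escape M E \<zeta> s h) \<Longrightarrow>
      g \<in> strategies M \<Longrightarrow> prob_buchi M E s g \<le> prob_buchi M E s f"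
proof -
  obtain \<zeta>0 where \<zeta>0: "0 < \<zeta>0" "\<zeta>0 < 1"
    and preserve: "\<And>\<zeta> x a. \<zeta>0 \<le> \<zeta> \<Longrightarrow> \<zeta> < 1 \<Longrightarrow> x \<in> states M \<Longrightarrow> a \<in> avail M x \<Longrightarrow>
      Q \<zeta> (U \<zeta>) x a = U \<zeta> x \<Longrightarrow> Q 1 Z x a = Z x"
    by (rule tight_actions_preserve_limit_value) blast
  show thesis
  proof (rule that[OF \<zeta>0])
    fix \<zeta> f g
    assume \<zeta>: "\<zeta>0 \<le> \<zeta>" "\<zeta> < 1" and f: "f \<in> strategies M" and g: "g \<in> strategies M"
      and min: "\<And>h. h \<in> strategies M \<Longrightarrow> escape M E \<zeta> s f \<le> escape M E \<zeta> s h"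
    have z: "0 < \<zeta>" using \<zeta> \<zeta>0 by simp
    have "prob_buchi M E s g \<le> 1 - Z s"
      using s g by (rule prob_buchi_le_limit_value)
    also have "\<dots> \<le> prob_buchi M E s f"
      using minimal_escape_eq_optimal_value[OF z \<zeta>(2) s f min] preserve[OF \<zeta>]
      by (intro minimal_escape_prob_buchi[OF z \<zeta>(2) s f]) auto
    finally show "prob_buchi M E s g \<le> prob_buchi M E s f" .
  qed
qed

end

end

lemma integral_pmf_of_bool: "(\<integral>x. of_bool (Q x) \<partial>measure_pmf p) = measure p {x. Q x}"
proof -
  have "(\<lambda>x. of_bool (Q x)) = indicat_real {x. Q x}"
    by (simp add: fun_eq_iff indicator_def)
  then show ?thesis by simp
qed

section \<open>The augmented product\<close>

text \<open>This and the next three lemmas identify the MDP with rewards, a record of a different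
  type, with the augmented MDP: rewards influence neither strategies nor run measures.\<close>

lemma is_path_cong:
  assumes "states M = states M'" "avail M = avail M'" "transition M = transition M'"
  shows "is_path M s xs = is_path M' s xs"
  using assms by (induction xs arbitrary: s) auto

lemma decision_runs_cong:
  assumes "states M = states M'" "avail M = avail M'" "transition M = transition M'"
  shows "decision_runs M = decision_runs M'"
  using is_path_cong[OF assms] assms by (simp add: decision_runs_def finite_runs_def)

lemma strategies_cong:
  assumes "states M = states M'" "avail M = avail M'" "transition M = transition M'"
  shows "strategies M = strategies M'"
  using assms by (simp add: strategies_def decision_runs_cong[OF assms])

lemma run_measure_cong:
  assumes "states M = states M'" "actions M = actions M'" "avail M = avail M'" "transition M = transition M'"
  shows "run_measure M f s = run_measure M' f s"
proof -
  have "next_step M f r = next_step M' f r" for r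
    using assms by (simp add: next_step_def decision_runs_cong[OF assms(1,3,4)])
  moreover have "steps M = steps M'"
    using assms by (simp add: steps_def)
  ultimately have "step_kernel M f s = step_kernel M' f s"
    by (intro ext) (simp only: step_kernel_def)
  with \<open>steps M = steps M'\<close> show ?thesis
    by (simp add: run_measure_def)
qed

lemma is_path_states: "is_path M s xs \<Longrightarrow> insert s (snd ` set xs) \<subseteq> states M"
  by (induction xs arbitrary: s) fastforce+

definition hits_target :: "('a \<times> 'p aug) option list \<Rightarrow> bool" where
  "hits_target xs \<longleftrightarrow> (\<exists>a. Some (a, Target) \<in> set xs)"

lemma hits_target_snoc: "hits_target (xs @ [y]) \<longleftrightarrow> hits_target xs \<or> (\<exists>a. y = Some (a, Target))"
  by (auto simp: hits_target_def)

section \<open>Decision runs of the product and of the augmented MDP\<close>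

locale automaton_product =
  fixes M :: "('s, 'a, 'l) lmdp" and A :: "('l, 'q) buchi"
  assumes automaton: "buchi_automaton A" and mdp: "labelled_mdp (alphabet A) M"
begin

abbreviation "P \<equiv> product_mdp M A"
abbreviation "G \<zeta> \<equiv> augmented_mdp M A \<zeta>"
abbreviation "E \<equiv> accepting M A"
text \<open>The rewarded transitions. Those diverted to \<open>Target\<close> must be added, since
  \<open>E\<close> contains only transitions between states of the form \<open>St\<close>.\<close>

abbreviation "E' \<equiv> {(x, y, x'). x' = Target \<or> (x, y, x') \<in> accepting M A}"
abbreviation "x0 \<equiv> St (start M, astart A)"

lemma Target_not_in_product: "Target \<notin> states P"
  by (auto simp: product_mdp_def)

lemma start_in_product: "x0 \<in> states P"
  using automaton mdp by (auto simp: product_mdp_def buchi_automaton_def labelled_mdp_def)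

lemma avail_Target [simp]: "avail P Target = {}" "avail (G \<zeta>) Target = {}"
  by (simp_all add: product_mdp_def augmented_mdp_def)

lemma avail_augmented [simp]: "avail (G \<zeta>) = avail P"
  by (simp add: augmented_mdp_def)

lemma transition_augmented [simp]: "transition (G \<zeta>) = augmented_transition M A \<zeta>"
  by (simp add: augmented_mdp_def)

lemma states_augmented [simp]: "states (G \<zeta>) = insert Target (states P)"
  by (simp add: augmented_mdp_def)

lemma actions_augmented [simp]: "actions (G \<zeta>) = actions P"
  by (simp add: augmented_mdp_def)

lemma transition_product [simp]: "transition P = product_transition M A"
  by (simp add: product_mdp_def)

lemma well_formed_product: "well_formed P"
proof -
  have "set_spmf (product_transition M A x y) \<subseteq> states P" if xy_in: "x \<in> states P" "y \<in> avail P x" for x y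
  proof -
    obtain s q a q' where xy: "x = St (s, q)" "y = (a, q')" "s \<in> states M" "q \<in> astates A" "a \<in> avail M s" "q' \<in> astates A"
      using xy_in by (cases y) (auto simp: product_mdp_def)
    have "set_spmf (transition M s a) \<subseteq> states M"
      using mdp xy unfolding labelled_mdp_def by blast
    then show ?thesis
      using xy by (auto simp: product_mdp_def product_transition_def set_bind_spmf split: if_splits intro!: imageI)
  qed
  moreover have "avail P x \<subseteq> actions P" if "x \<in> states P" for x
    using that mdp by (force simp: product_mdp_def labelled_mdp_def)
  ultimately show ?thesis
    using automaton mdp unfolding well_formed_def transition_product
    by (auto simp: product_mdp_def buchi_automaton_def labelled_mdp_def)
qed

lemma Target_notin_product_transition: "Some Target \<notin> set_pmf (product_transition M A x y)"
  by (auto simp: product_transition_def in_set_spmf[symmetric] set_bind_spmf split: prod.splits aug.splits if_splits)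

lemma set_augmented_transition:
  "set_spmf (augmented_transition M A \<zeta> x y) \<subseteq> insert Target (set_spmf (product_transition M A x y))"
  by (auto simp: augmented_transition_def set_bind_spmf in_set_spmf split: if_splits)

lemma well_formed_augmented: "well_formed (G \<zeta>)"
  using well_formed_product set_augmented_transition[of \<zeta>]
  unfolding well_formed_def by (fastforce simp: ball_Un)

sublocale P: finite_mdp P
  by unfold_locales (rule well_formed_product)

lemma spmf_augmented_pos_iff:
  assumes "0 < \<zeta>" "\<zeta> < 1"
  shows "0 < spmf (augmented_transition M A \<zeta> x y) (St z) \<longleftrightarrow> 0 < spmf (product_transition M A x y) (St z)"
  using assms by (simp add: spmf_augmented_transition_St zero_less_mult_iff)

text \<open>\<open>Target\<close> has no available action, so a path that does not end there never
  visits it; between other states the factor \<zeta> is positive and leaves the supports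
  unchanged.\<close>

lemma is_path_augmented:
  assumes "0 < \<zeta>" "\<zeta> < 1"
  shows "is_path (G \<zeta>) x ys \<and> last_state (x, ys) \<noteq> Target \<longleftrightarrow> is_path P x ys"
proof (induction ys arbitrary: x)
  case Nil
  then show ?case using Target_not_in_product by auto
next
  case (Cons b ys)
  obtain y x' where b: "b = (y, x')" by (cases b)
  have last: "last_state (x, b # ys) = last_state (x', ys)" by (simp add: b)
  show ?case
  proof (cases x')
    case Target
    have "\<not> is_path P x' ys"
      using is_path_states[of P x' ys] Target_not_in_product Target by auto
    then show ?thesis
      using Cons[of x'] unfolding last by (auto simp: b)
  next
    case (St z)
    show ?thesis
      using Cons[of x'] spmf_augmented_pos_iff[OF assms] unfolding last
      by (cases x) (auto simp: b St)
  qed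
qed

text \<open>Only paths ending in \<open>Target\<close> are new, and there is nothing to decide after
  them.\<close>

lemma decision_runs_augmented:
  assumes "0 < \<zeta>" "\<zeta> < 1"
  shows "decision_runs (G \<zeta>) = decision_runs P"
proof -
  have "r \<in> decision_runs (G \<zeta>) \<longleftrightarrow> r \<in> decision_runs P" for r
    using is_path_augmented[OF assms, of "fst r" "snd r"]
    by (cases "last_state r = Target"; cases r)
      (auto simp: decision_runs_def finite_runs_def simp del: last_state.simps)
  then show ?thesis by blast
qed

lemma strategies_augmented:
  "0 < \<zeta> \<Longrightarrow> \<zeta> < 1 \<Longrightarrow> strategies (G \<zeta>) = strategies P"
  by (simp add: strategies_def decision_runs_augmented)

lemma strategies_augmented_rmdp: "strategies (augmented_rmdp M A \<zeta>) = strategies (G \<zeta>)"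
  by (rule strategies_cong) (simp_all add: augmented_rmdp_def)

lemma run_measure_augmented_rmdp: "run_measure (augmented_rmdp M A \<zeta>) f s = run_measure (G \<zeta>) f s"
  by (rule run_measure_cong) (simp_all add: augmented_rmdp_def)

lemma decision_run_no_target:
  assumes "(x, map the xs) \<in> decision_runs P" "None \<notin> set xs"
  shows "\<not> hits_target xs"
proof
  assume "hits_target xs"
  then obtain a where "Some (a, Target) \<in> set xs" by (auto simp: hits_target_def)
  then have "Target \<in> snd ` set (map the xs)" by force
  moreover have "is_path P x (map the xs)"
    using assms(1) by (simp add: decision_runs_def finite_runs_def)
  ultimately show False
    using is_path_states[of P x "map the xs"] Target_not_in_product by blast
qed

text \<open>Averages out the coin that decides between the proper successor and
  \<open>Target\<close>.\<close>

lemma integral_augmented_transition: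
  fixes h :: "('s \<times> 'q) aug option \<Rightarrow> real"
  assumes "0 < \<zeta>" "\<zeta> < 1" "x \<in> states P" "y \<in> avail P x"
  shows "(\<integral>z. h z \<partial>measure_pmf (augmented_transition M A \<zeta> x y)) =
    (\<integral>z. (case z of None \<Rightarrow> h None | Some x' \<Rightarrow>
       if (x, y, x') \<in> E then h (Some x') * \<zeta> + h (Some Target) * (1 - \<zeta>) else h (Some x'))
     \<partial>measure_pmf (product_transition M A x y))"
proof -
  have "finite (set_pmf (product_transition M A x y))"
    using P.finite_transition[OF assms(3,4)] by simp
  then show ?thesis
    unfolding augmented_transition_def bind_spmf_def
    using assms(1,2)
    by (subst integral_bind_pmf_finite)
      (auto split: option.split simp: option.case_distrib[of "\<lambda>p. measure_pmf.expectation p h"] if_distrib[of "\<lambda>p. measure_pmf.expectation p h"]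
        intro!: Bochner_Integration.integral_cong)
qed

section \<open>Comparison of finite prefixes in the product and in the augmented MDP\<close>

context
  fixes \<zeta> :: real and f
  assumes \<zeta>: "0 < \<zeta>" "\<zeta> < 1" and f: "f \<in> strategies P"
begin

interpretation BP: buchi_run P f x0 E
  using f start_in_product by unfold_locales

interpretation BG: strategy_run "G \<zeta>" f x0
  using f start_in_product well_formed_augmented strategies_augmented[OF \<zeta>] by unfold_locales auto

lemma integral_next_augmented:
  fixes h :: "_ \<Rightarrow> real"
  assumes r: "(x0, map the xs) \<in> decision_runs P" "None \<notin> set xs"
  shows "(\<integral>y. h y \<partial>next_pmf (G \<zeta>) f x0 xs) =
    (\<integral>a. (\<integral>z. (case z of None \<Rightarrow> h None | Some x' \<Rightarrow>
       if (last_state (x0, map the xs), a, x') \<in> E then h (Some (a, x')) * \<zeta> + h (Some (a, Target)) * (1 - \<zeta>) else h (Some (a, x')))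
     \<partial>measure_pmf (product_transition M A (last_state (x0, map the xs)) a)) \<partial>f (x0, map the xs))"
proof -
  let ?r = "(x0, map the xs)"
  let ?x = "last_state ?r"
  have x: "?x \<in> states P" by (rule P.last_state_in[OF r(1)])
  have a: "a \<in> avail P ?x" if "a \<in> set_pmf (f ?r)" for a
    using BP.set_strategy[OF r(1)] that by blast
  have r': "?r \<in> decision_runs (G \<zeta>)" using r decision_runs_augmented[OF \<zeta>] by simp
  have "next_pmf (G \<zeta>) f x0 xs = bind_pmf (f ?r) (\<lambda>a. map_spmf (Pair a) (augmented_transition M A \<zeta> ?x a))"
    using r r' by (simp add: next_pmf_def next_step_def del: last_state.simps)
  moreover have "finite (set_pmf (augmented_transition M A \<zeta> ?x a))" if "a \<in> set_pmf (f ?r)" for a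
    using BG.finite_transition[of ?x a] x a[OF that] by simp
  ultimately have "(\<integral>y. h y \<partial>next_pmf (G \<zeta>) f x0 xs) =
      (\<integral>a. (\<integral>z. h (map_option (Pair a) z) \<partial>measure_pmf (augmented_transition M A \<zeta> ?x a)) \<partial>f ?r)"
    using BP.finite_strategy[OF r(1)] by (simp add: integral_bind_pmf_finite del: last_state.simps)
  also have "\<dots> = (\<integral>a. (\<integral>z. (case z of None \<Rightarrow> h None | Some x' \<Rightarrow>
       if (?x, a, x') \<in> E then h (Some (a, x')) * \<zeta> + h (Some (a, Target)) * (1 - \<zeta>) else h (Some (a, x')))
     \<partial>measure_pmf (product_transition M A ?x a)) \<partial>f ?r)"
  proof (intro integral_cong_AE)
    show "AE a in f ?r. (\<integral>z. h (map_option (Pair a) z) \<partial>measure_pmf (augmented_transition M A \<zeta> ?x a)) =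
      (\<integral>z. (case z of None \<Rightarrow> h None | Some x' \<Rightarrow>
       if (?x, a, x') \<in> E then h (Some (a, x')) * \<zeta> + h (Some (a, Target)) * (1 - \<zeta>) else h (Some (a, x')))
     \<partial>measure_pmf (product_transition M A ?x a))"
      unfolding AE_measure_pmf_iff
    proof
      fix a assume a': "a \<in> set_pmf (f ?r)"
      show "(\<integral>z. h (map_option (Pair a) z) \<partial>measure_pmf (augmented_transition M A \<zeta> ?x a)) =
        (\<integral>z. (case z of None \<Rightarrow> h None | Some x' \<Rightarrow>
         if (?x, a, x') \<in> E then h (Some (a, x')) * \<zeta> + h (Some (a, Target)) * (1 - \<zeta>) else h (Some (a, x')))
       \<partial>measure_pmf (product_transition M A ?x a))"
        unfolding integral_augmented_transition[OF \<zeta> x a[OF a']]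
        by (intro Bochner_Integration.integral_cong) (auto split: option.split)
    qed
  qed auto
  finally show ?thesis .
qed

lemma integral_next_product:
  fixes h :: "_ \<Rightarrow> real"
  assumes r: "(x0, map the xs) \<in> decision_runs P" "None \<notin> set xs"
  shows "(\<integral>y. h y \<partial>next_pmf P f x0 xs) =
    (\<integral>a. (\<integral>z. h (map_option (Pair a) z)
     \<partial>measure_pmf (product_transition M A (last_state (x0, map the xs)) a)) \<partial>f (x0, map the xs))"
proof -
  let ?r = "(x0, map the xs)"
  let ?x = "last_state ?r"
  have x: "?x \<in> states P" by (rule P.last_state_in[OF r(1)])
  have a: "a \<in> avail P ?x" if "a \<in> set_pmf (f ?r)" for a
    using BP.set_strategy[OF r(1)] that by blast
  have "next_pmf P f x0 xs = bind_pmf (f ?r) (\<lambda>a. map_spmf (Pair a) (product_transition M A ?x a))"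
    using r by (simp add: next_pmf_def next_step_def del: last_state.simps)
  moreover have "finite (set_pmf (product_transition M A ?x a))" if "a \<in> set_pmf (f ?r)" for a
    using P.finite_transition[of ?x a] x a[OF that] by simp
  ultimately show ?thesis
    using BP.finite_strategy[OF r(1)] by (simp add: integral_bind_pmf_finite del: last_state.simps)
qed

lemma next_pmf_stop:
  assumes "(x0, map the xs) \<notin> decision_runs P \<or> None \<in> set xs"
  shows "next_pmf (G \<zeta>) f x0 xs = return_pmf None" "next_pmf P f x0 xs = return_pmf None"
  using assms decision_runs_augmented[OF \<zeta>] by (auto simp: next_pmf_def next_step_def)

text \<open>An accepting transition is survived with probability \<zeta>, which matches the increase
  of \<open>hits\<close> by one on the right; other transitions change neither side.\<close>

lemma transfer_step:
  fixes F :: "_ \<Rightarrow> real"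
  shows "(\<integral>y. F y * of_bool (\<not> (\<exists>a. y = Some (a, Target))) \<partial>next_pmf (G \<zeta>) f x0 xs) * \<zeta> ^ hits E x0 xs =
    (\<integral>y. F y * \<zeta> ^ hits E x0 (xs @ [y]) \<partial>next_pmf P f x0 xs)"
proof (cases "(x0, map the xs) \<in> decision_runs P \<and> None \<notin> set xs")
  case True
  then have r: "(x0, map the xs) \<in> decision_runs P" "None \<notin> set xs" by auto
  let ?x = "last_state (x0, map the xs)"
  let ?h = "\<lambda>y. F y * of_bool (\<not> (\<exists>a. y = Some (a, Target)))"
  have *: "(\<integral>z. (case z of None \<Rightarrow> ?h None | Some x' \<Rightarrow>
       if (?x, a, x') \<in> E then ?h (Some (a, x')) * \<zeta> + ?h (Some (a, Target)) * (1 - \<zeta>) else ?h (Some (a, x')))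
     \<partial>measure_pmf (product_transition M A ?x a)) * \<zeta> ^ hits E x0 xs =
     (\<integral>z. F (map_option (Pair a) z) * \<zeta> ^ hits E x0 (xs @ [map_option (Pair a) z])
     \<partial>measure_pmf (product_transition M A ?x a))" (is "(\<integral>z. ?L z \<partial>_) * _ = (\<integral>z. ?R z \<partial>_)") for a
  proof -
    have "?L z * \<zeta> ^ hits E x0 xs = ?R z" if "z \<in> set_pmf (product_transition M A ?x a)" for z
      using that r(2) Target_notin_product_transition[of ?x a]
      by (cases z) (auto simp: hits_snoc_None hits_snoc_Some simp del: last_state.simps)
    then have "(\<integral>z. ?L z * \<zeta> ^ hits E x0 xs \<partial>measure_pmf (product_transition M A ?x a)) =
      (\<integral>z. ?R z \<partial>measure_pmf (product_transition M A ?x a))"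
      by (intro integral_cong_AE) (auto simp: AE_measure_pmf_iff simp del: last_state.simps)
    then show ?thesis by simp
  qed
  show ?thesis
    unfolding integral_next_augmented[OF r] integral_next_product[OF r] *[symmetric]
    by (rule integral_mult_left_zero[symmetric])
next
  case False
  then show ?thesis by (simp add: next_pmf_stop hits_snoc_None)
qed

text \<open>Killing a run at each accepting transition amounts to reweighting it by \<open>\<zeta>\<close> per transition.\<close>

lemma transfer:
  fixes F :: "_ \<Rightarrow> real"
  shows "(\<integral>xs. F xs * of_bool (\<not> hits_target xs) \<partial>prefix_pmf (G \<zeta>) f x0 n) =
    (\<integral>xs. F xs * \<zeta> ^ hits E x0 xs \<partial>prefix_pmf P f x0 n)"
proof (induction n arbitrary: F)
  case 0
  show ?case by (simp add: hits_target_def)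
next
  case (Suc n)
  have "(\<integral>xs. F xs * of_bool (\<not> hits_target xs) \<partial>prefix_pmf (G \<zeta>) f x0 (Suc n)) =
      (\<integral>xs. (\<integral>y. F (xs @ [y]) * of_bool (\<not> hits_target (xs @ [y])) \<partial>next_pmf (G \<zeta>) f x0 xs) \<partial>prefix_pmf (G \<zeta>) f x0 n)"
    by (rule BG.integral_prefix_Suc)
  also have "\<dots> = (\<integral>xs. (\<integral>y. F (xs @ [y]) * of_bool (\<not> (\<exists>a. y = Some (a, Target))) \<partial>next_pmf (G \<zeta>) f x0 xs) *
      of_bool (\<not> hits_target xs) \<partial>prefix_pmf (G \<zeta>) f x0 n)"
    by (intro Bochner_Integration.integral_cong) (auto simp: hits_target_snoc)
  also have "\<dots> = (\<integral>xs. (\<integral>y. F (xs @ [y]) * of_bool (\<not> (\<exists>a. y = Some (a, Target))) \<partial>next_pmf (G \<zeta>) f x0 xs) *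
      \<zeta> ^ hits E x0 xs \<partial>prefix_pmf P f x0 n)"
    by (rule Suc)
  also have "\<dots> = (\<integral>xs. (\<integral>y. F (xs @ [y]) * \<zeta> ^ hits E x0 (xs @ [y]) \<partial>next_pmf P f x0 xs) \<partial>prefix_pmf P f x0 n)"
    unfolding transfer_step ..
  also have "\<dots> = (\<integral>xs. F xs * \<zeta> ^ hits E x0 xs \<partial>prefix_pmf P f x0 (Suc n))"
    by (rule BP.integral_prefix_Suc[symmetric])
  finally show ?case .
qed

text \<open>An accepting transition adds \<open>1 - \<zeta>\<close> to the scaled reward, whether
  diverted or not, and leads to \<open>Target\<close> with conditional probability
  \<open>1 - \<zeta>\<close>; the two contributions cancel in expectation.\<close>

lemma reward_martingale_step:
  "(\<integral>y. (1 - \<zeta>) * real (hits E' x0 (xs @ [y])) - of_bool (hits_target (xs @ [y])) \<partial>next_pmf (G \<zeta>) f x0 xs) =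
    (1 - \<zeta>) * real (hits E' x0 xs) - of_bool (hits_target xs)"
proof (cases "(x0, map the xs) \<in> decision_runs P \<and> None \<notin> set xs")
  case True
  then have r: "(x0, map the xs) \<in> decision_runs P" "None \<notin> set xs" by auto
  have nt: "\<not> hits_target xs" using r by (rule decision_run_no_target)
  let ?x = "last_state (x0, map the xs)"
  let ?h = "\<lambda>y. (1 - \<zeta>) * real (hits E' x0 (xs @ [y])) - of_bool (hits_target (xs @ [y]))"
  have "(\<integral>z. (case z of None \<Rightarrow> ?h None | Some x' \<Rightarrow>
       if (?x, a, x') \<in> E then ?h (Some (a, x')) * \<zeta> + ?h (Some (a, Target)) * (1 - \<zeta>) else ?h (Some (a, x')))
     \<partial>measure_pmf (product_transition M A ?x a)) = (1 - \<zeta>) * real (hits E' x0 xs)" (is "(\<integral>z. ?L z \<partial>_) = _") for a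
  proof -
    have "?L z = (1 - \<zeta>) * real (hits E' x0 xs)" if "z \<in> set_pmf (product_transition M A ?x a)" for z
      using that r(2) nt Target_notin_product_transition[of ?x a]
      by (cases z) (auto simp: hits_snoc_None hits_snoc_Some hits_target_snoc algebra_simps simp del: last_state.simps)
    then have "(\<integral>z. ?L z \<partial>measure_pmf (product_transition M A ?x a)) =
        (\<integral>z. (1 - \<zeta>) * real (hits E' x0 xs) \<partial>measure_pmf (product_transition M A ?x a))"
      by (intro integral_cong_AE) (auto simp: AE_measure_pmf_iff simp del: last_state.simps)
    then show ?thesis by simp
  qed
  then show ?thesis
    unfolding integral_next_augmented[OF r] using nt by (simp del: last_state.simps)
next
  case False
  then show ?thesis by (simp add: next_pmf_stop hits_snoc_None hits_target_snoc)
qed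

text \<open>The martingale starts at 0, so its expectation stays 0.\<close>

lemma expected_hits:
  "(1 - \<zeta>) * (\<integral>xs. real (hits E' x0 xs) \<partial>prefix_pmf (G \<zeta>) f x0 n) =
     measure (prefix_pmf (G \<zeta>) f x0 n) {xs. hits_target xs}"
proof -
  have "(\<integral>xs. (1 - \<zeta>) * real (hits E' x0 xs) - of_bool (hits_target xs) \<partial>prefix_pmf (G \<zeta>) f x0 n) = 0"
  proof (induction n)
    case 0
    show ?case by (simp add: hits_target_def)
  next
    case (Suc n)
    then show ?case unfolding BG.integral_prefix_Suc reward_martingale_step .
  qed
  moreover have "(\<integral>xs. of_bool (hits_target xs) \<partial>prefix_pmf (G \<zeta>) f x0 n) =
      measure (prefix_pmf (G \<zeta>) f x0 n) {xs. hits_target xs}"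
    by (simp add: integral_pmf_of_bool)
  ultimately show ?thesis
    by (simp add: BG.integrable_prefix)
qed

text \<open>The complement is \<open>transfer\<close> with \<open>F\<close> constantly 1: surviving
  \<open>n\<close> steps has the expected weight \<open>\<zeta> ^ hits\<close>.\<close>

lemma prob_hits_target:
  "measure (prefix_pmf (G \<zeta>) f x0 n) {xs. hits_target xs} = 1 - BP.stage_value n \<zeta> (\<lambda>_. 1)"
proof -
  let ?D = "prefix_pmf (G \<zeta>) f x0 n"
  have "measure ?D {xs. hits_target xs} = 1 - measure ?D {xs. \<not> hits_target xs}"
    using measure_pmf.prob_compl[of "{xs. \<not> hits_target xs}" ?D] by (simp add: Compl_eq_Diff_UNIV[symmetric] Collect_neg_eq[symmetric])
  also have "measure ?D {xs. \<not> hits_target xs} = (\<integral>xs. 1 * of_bool (\<not> hits_target xs) \<partial>?D)"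
    by (simp add: integral_pmf_of_bool)
  also have "\<dots> = BP.stage_value n \<zeta> (\<lambda>_. 1)"
    unfolding transfer by (simp add: BP.stage_value_def end_value_def)
  finally show ?thesis .
qed

section \<open>Reachability and total reward in terms of \<open>escape\<close>\<close>

text \<open>Reaching \<open>Target\<close> is the increasing union of reaching it within
  \<open>n\<close> steps; continuity from below meets the limit of the stage values.\<close>

lemma prob_reach_augmented: "prob_reach (G \<zeta>) Target x0 f = 1 - escape P E \<zeta> x0 f"
proof (rule LIMSEQ_unique)
  let ?R = "run_measure (G \<zeta>) f x0"
  interpret prob_space ?R by (rule BG.prob_space_run)
  let ?T = "\<lambda>n. {\<omega> \<in> space ?R. hits_target (run_prefix n \<omega>)}"
  have meas: "?T n \<in> sets ?R" for n
  proof -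
    have "Measurable.pred ?R (\<lambda>\<omega>. hits_target (run_prefix n \<omega>))"
      by (rule measurable_compose[OF BG.run_prefix_measurable_run]) simp
    then show ?thesis by simp
  qed
  have "(\<lambda>n. measure ?R (?T n)) \<longlonglongrightarrow> measure ?R (\<Union>n. ?T n)"
  proof (rule finite_Lim_measure_incseq)
    show "range ?T \<subseteq> sets ?R" using meas by auto
    show "incseq ?T" by (rule incseq_SucI) (auto simp: run_prefix_Suc hits_target_snoc)
  qed
  moreover have "(\<Union>n. ?T n) = {\<omega> \<in> space ?R. \<exists>i. state_at x0 \<omega> i = Some Target}"
  proof -
    have "(\<exists>n. hits_target (run_prefix n \<omega>)) \<longleftrightarrow> (\<exists>i. state_at x0 \<omega> i = Some Target)" for \<omega> :: "(('s \<times> 'q) aug, 'a \<times> 'q) run"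
    proof
      assume "\<exists>n. hits_target (run_prefix n \<omega>)"
      then obtain n a i where "i < n" "\<omega> i = Some (a, Target)"
        by (auto simp: hits_target_def run_prefix_def image_iff) metis
      then show "\<exists>i. state_at x0 \<omega> i = Some Target"
        by (intro exI[of _ "Suc i"]) (simp add: state_at_def)
    next
      assume "\<exists>i. state_at x0 \<omega> i = Some Target"
      then obtain i where "state_at x0 \<omega> i = Some Target" ..
      then obtain j a where "\<omega> j = Some (a, Target)"
        by (cases i) (auto simp: state_at_def)
      then show "\<exists>n. hits_target (run_prefix n \<omega>)"
        by (intro exI[of _ "Suc j"]) (auto simp: run_prefix_Suc hits_target_snoc)
    qed
    then show ?thesis by auto
  qed
  ultimately show "(\<lambda>n. measure ?R (?T n)) \<longlonglongrightarrow> prob_reach (G \<zeta>) Target x0 f"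
    by (simp add: prob_reach_def)
  show "(\<lambda>n. measure ?R (?T n)) \<longlonglongrightarrow> 1 - escape P E \<zeta> x0 f"
    unfolding BG.prob_prefix prob_hits_target
    by (intro tendsto_intros BP.escape_LIMSEQ \<zeta>)
qed

lemma total_augmented:
  "total (augmented_rmdp M A \<zeta>) x0 \<omega> = (\<Sum>i. of_bool (takes E' x0 \<omega> i))"
  unfolding total_def takes_def
  by (intro suminf_cong) (auto simp: augmented_rmdp_def split: option.split)

text \<open>Sum and integral commute for nonnegative rewards. The first \<open>n\<close> terms give
  the expected number of hits, known from \<open>expected_hits\<close> and
  \<open>prob_hits_target\<close>, and its limit is finite.\<close>

lemma etotal_augmented:
  "etotal (augmented_rmdp M A \<zeta>) x0 f = ennreal ((1 - escape P E \<zeta> x0 f) / (1 - \<zeta>))"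
proof (rule LIMSEQ_unique)
  let ?R = "run_measure (G \<zeta>) f x0"
  interpret BG': buchi_run "G \<zeta>" f x0 E' by unfold_locales
  have m: "(\<lambda>\<omega>. of_bool (takes E' x0 \<omega> i) :: ennreal) \<in> borel_measurable ?R" for i
    by (rule measurable_compose[OF BG'.takes_measurable]) simp
  have "etotal (augmented_rmdp M A \<zeta>) x0 f = (\<Sum>i. \<integral>\<^sup>+\<omega>. of_bool (takes E' x0 \<omega> i) \<partial>?R)"
    unfolding etotal_def total_augmented run_measure_augmented_rmdp
    by (rule nn_integral_suminf) (rule m)
  then show "(\<lambda>n. \<Sum>i<n. \<integral>\<^sup>+\<omega>. of_bool (takes E' x0 \<omega> i) \<partial>?R) \<longlonglongrightarrow> etotal (augmented_rmdp M A \<zeta>) x0 f"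
    using summable_LIMSEQ[of "\<lambda>i. \<integral>\<^sup>+\<omega>. of_bool (takes E' x0 \<omega> i) \<partial>?R"] by simp
  have "(\<Sum>i<n. \<integral>\<^sup>+\<omega>. of_bool (takes E' x0 \<omega> i) \<partial>?R) = ennreal ((1 - BP.stage_value n \<zeta> (\<lambda>_. 1)) / (1 - \<zeta>))" for n
  proof -
    have "(\<Sum>i<n. of_bool (takes E' x0 \<omega> i)) = ennreal (real (hits E' x0 (run_prefix n \<omega>)))" for \<omega>
    proof -
      have "(\<Sum>i<n. of_bool (takes E' x0 \<omega> i) :: ennreal) = of_nat (card ({..<n} \<inter> {i. takes E' x0 \<omega> i}))"
        by simp
      also have "{..<n} \<inter> {i. takes E' x0 \<omega> i} = {i. i < n \<and> takes E' x0 \<omega> i}" by auto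
      finally show ?thesis by (simp add: hits_run_prefix ennreal_of_nat_eq_real_of_nat)
    qed
    then have "(\<Sum>i<n. \<integral>\<^sup>+\<omega>. of_bool (takes E' x0 \<omega> i) \<partial>?R) = (\<integral>\<^sup>+\<omega>. ennreal (real (hits E' x0 (run_prefix n \<omega>))) \<partial>?R)"
      by (simp add: nn_integral_sum[symmetric] m)
    also have "\<dots> = (\<integral>\<^sup>+xs. ennreal (real (hits E' x0 xs)) \<partial>prefix_pmf (G \<zeta>) f x0 n)"
      by (rule BG.nn_integral_prefix)
    also have "\<dots> = ennreal (\<integral>xs. real (hits E' x0 xs) \<partial>prefix_pmf (G \<zeta>) f x0 n)"
      by (intro nn_integral_eq_integral BG.integrable_prefix) simp
    also have "(\<integral>xs. real (hits E' x0 xs) \<partial>prefix_pmf (G \<zeta>) f x0 n) = (1 - BP.stage_value n \<zeta> (\<lambda>_. 1)) / (1 - \<zeta>)"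
      using expected_hits[of n] \<zeta> unfolding prob_hits_target by (simp add: field_simps)
    finally show ?thesis .
  qed
  then show "(\<lambda>n. \<Sum>i<n. \<integral>\<^sup>+\<omega>. of_bool (takes E' x0 \<omega> i) \<partial>?R) \<longlonglongrightarrow> ennreal ((1 - escape P E \<zeta> x0 f) / (1 - \<zeta>))"
    using \<zeta> by (auto intro!: tendsto_intros BP.escape_LIMSEQ)
qed

lemma escape_product_bounds: "0 \<le> escape P E \<zeta> x0 f" "escape P E \<zeta> x0 f \<le> 1"
  using BP.escape_bounds[OF \<zeta>] .

lemma escape_product_eq_0_iff: "escape P E \<zeta> x0 f = 0 \<longleftrightarrow> psat M A x0 f = 1"
  unfolding psat_def by (rule BP.escape_eq_0_iff[OF \<zeta>])

lemma psat_le_one: "psat M A x0 f \<le> 1"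
  using BP.prob_buchi_le_escape[OF \<zeta>] escape_product_bounds unfolding psat_def by simp

end

end

section \<open>Translation of the results on \<open>escape\<close> into the five items\<close>

theorem theorem2:
  fixes M :: "('s, 'a, 'l) lmdp"
    and A :: "('l, 'q) buchi"
    and \<zeta> :: real
  assumes "buchi_automaton A"
    and "labelled_mdp (alphabet A) M"
    and "good_for_mdps A"
    and "0 < \<zeta>" and "\<zeta> < 1"
  shows "let x0 = St (start M, astart A) in
     (strategies (augmented_rmdp M A \<zeta>) = strategies (augmented_mdp M A \<zeta>) \<and>
      strategies (augmented_mdp M A \<zeta>) = strategies (product_mdp M A)) \<and>
     (\<forall>f\<in>strategies (augmented_rmdp M A \<zeta>).
        ennreal (prob_reach (augmented_mdp M A \<zeta>) Target x0 f) =
          ennreal (1 - \<zeta>) * etotal (augmented_rmdp M A \<zeta>) x0 f \<and>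
        (\<forall>r. etotal (augmented_rmdp M A \<zeta>) x0 f = r \<longleftrightarrow>
             ennreal (prob_reach (augmented_mdp M A \<zeta>) Target x0 f) = ennreal (1 - \<zeta>) * r)) \<and>
     (\<forall>f\<in>strategies (augmented_rmdp M A \<zeta>).
        etotal (augmented_rmdp M A \<zeta>) x0 f \<in> {0..ennreal (1 / (1 - \<zeta>))}) \<and>
     (\<forall>f\<in>strategies (product_mdp M A).
        psat M A x0 f = 1 \<longleftrightarrow> etotal (augmented_rmdp M A \<zeta>) x0 f = ennreal (1 / (1 - \<zeta>))) \<and>
     (\<exists>\<zeta>0. 0 < \<zeta>0 \<and> \<zeta>0 < 1 \<and>
        (\<forall>\<zeta>'. \<zeta>0 \<le> \<zeta>' \<and> \<zeta>' < 1 \<longrightarrow>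
          (\<forall>f\<in>strategies (augmented_rmdp M A \<zeta>').
             (\<forall>g\<in>strategies (augmented_rmdp M A \<zeta>').
                etotal (augmented_rmdp M A \<zeta>') x0 g \<le> etotal (augmented_rmdp M A \<zeta>') x0 f) \<longrightarrow>
             psat M A x0 f = (SUP g\<in>strategies (product_mdp M A). psat M A x0 g))))"
proof -
  interpret automaton_product M A
    using assms by unfold_locales
  note \<zeta> = assms(4,5)
  have strategies: "strategies (augmented_rmdp M A z) = strategies P" if "0 < z" "z < 1" for z
    using strategies_augmented_rmdp strategies_augmented[OF that] by simp
  have reach: "ennreal (prob_reach (G \<zeta>) Target x0 f) = ennreal (1 - \<zeta>) * etotal (augmented_rmdp M A \<zeta>) x0 f"
    if "f \<in> strategies P" for f
    using \<zeta> escape_product_bounds[OF \<zeta> that]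
    unfolding prob_reach_augmented[OF \<zeta> that] etotal_augmented[OF \<zeta> that]
    by (subst ennreal_mult[symmetric]) auto
  \<comment> \<open>Multiplication by \<open>1 - \<zeta>\<close> is injective on the extended reals
    because this factor is neither 0 nor infinite; \<open>r\<close> may be infinite.\<close>
  have reach_iff: "etotal (augmented_rmdp M A \<zeta>) x0 f = r \<longleftrightarrow>
      ennreal (prob_reach (G \<zeta>) Target x0 f) = ennreal (1 - \<zeta>) * r" if "f \<in> strategies P" for f r
    unfolding reach[OF that] using \<zeta> by (auto simp: ennreal_mult_cancel_left)
  have bound: "etotal (augmented_rmdp M A \<zeta>) x0 f \<in> {0..ennreal (1 / (1 - \<zeta>))}" if "f \<in> strategies P" for f
    using \<zeta> escape_product_bounds[OF \<zeta> that] unfolding etotal_augmented[OF \<zeta> that]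
    by (auto intro!: ennreal_leI divide_right_mono)
  \<comment> \<open>The two quotients agree exactly if \<open>escape\<close> is 0, which is the
    Buechi condition with probability 1.\<close>
  have almost_sure: "psat M A x0 f = 1 \<longleftrightarrow> etotal (augmented_rmdp M A \<zeta>) x0 f = ennreal (1 / (1 - \<zeta>))"
    if "f \<in> strategies P" for f
    using \<zeta> escape_product_bounds[OF \<zeta> that]
    unfolding etotal_augmented[OF \<zeta> that] escape_product_eq_0_iff[OF \<zeta> that, symmetric]
    by (subst ennreal_inj) (auto simp: field_simps)
  obtain \<zeta>0 where \<zeta>0: "0 < \<zeta>0" "\<zeta>0 < 1"
    and optimal: "\<And>z f g. \<zeta>0 \<le> z \<Longrightarrow> z < 1 \<Longrightarrow> f \<in> strategies P \<Longrightarrow>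
      (\<And>h. h \<in> strategies P \<Longrightarrow> escape P E z x0 f \<le> escape P E z x0 h) \<Longrightarrow>
      g \<in> strategies P \<Longrightarrow> prob_buchi P E x0 g \<le> prob_buchi P E x0 f"
    by (rule P.minimal_escape_imp_buchi_optimal[OF start_in_product]) blast
  have "psat M A x0 f = (SUP g\<in>strategies P. psat M A x0 g)"
    if z: "\<zeta>0 \<le> z" "z < 1" and f: "f \<in> strategies (augmented_rmdp M A z)"
      and max: "\<forall>g\<in>strategies (augmented_rmdp M A z).
        etotal (augmented_rmdp M A z) x0 g \<le> etotal (augmented_rmdp M A z) x0 f" for z f
  proof (rule antisym)
    have z': "0 < z" "z < 1" using z \<zeta>0 by auto
    note S = strategies[OF z']
    have f': "f \<in> strategies P" using f S by simp
    \<comment> \<open>By the formula for \<open>etotal\<close>, maximal reward means minimal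
      \<open>escape\<close>.\<close>
    have "escape P E z x0 f \<le> escape P E z x0 h" if h: "h \<in> strategies P" for h
    proof -
      have "ennreal ((1 - escape P E z x0 h) / (1 - z)) \<le> ennreal ((1 - escape P E z x0 f) / (1 - z))"
        using max h unfolding S by (simp flip: etotal_augmented[OF z'] add: f')
      then have "(1 - escape P E z x0 h) / (1 - z) \<le> (1 - escape P E z x0 f) / (1 - z)"
        using z' escape_product_bounds[OF z' f'] by (subst (asm) ennreal_le_iff) auto
      then show ?thesis
        using z' by (simp add: divide_le_cancel)
    qed
    then have "psat M A x0 g \<le> psat M A x0 f" if "g \<in> strategies P" for g
      unfolding psat_def using optimal[OF z f' _ that] by blast
    then show "(SUP g\<in>strategies P. psat M A x0 g) \<le> psat M A x0 f"
      using f' by (intro cSUP_least) auto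
    \<comment> \<open>The supremum is one of reals, so the upper bound 1 has to be supplied.\<close>
    show "psat M A x0 f \<le> (SUP g\<in>strategies P. psat M A x0 g)"
      using f' psat_le_one[OF z'] by (intro cSUP_upper bdd_aboveI[of _ 1]) auto
  qed
  then show ?thesis
    unfolding Let_def strategies[OF \<zeta>] strategies_augmented[OF \<zeta>]
    using reach reach_iff bound almost_sure \<zeta>0 by blast
qed

end
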